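(* Let $A>0$ and $1<p<1+\sqrt{2}$, and let $u\in C^2(\mathbb{R}^3\times[0,\infty))$ be a real-valued function satisfying $\Box u\ge A|u|^p$ in $\mathbb{R}^3\times(0,\infty)$. Let $u^0$ be the free solution with the same initial data as $u$, i.e. the solution of $\Box u^0=0$ for $x\in\mathbb{R}^3$, $t>0$, with $u^0(x,0)=u(x,0)$ and $u^0_t(x,0)=u_t(x,0)$ for $x\in\mathbb{R}^3$. Suppose there exists a point $(x^0,t_0)\in\mathbb{R}^3\times\mathbb{R}=\mathbb{R}^4$ such that $u^0(x,t)\ge 0$ for all $(x,t)\in\Gamma^+(x^0,t_0)$. Then $u$ has compact support and $\operatorname{supp} u\subset\Gamma^-(x^0,t_0)$.
   Context: $\Box$ denotes the d'Alembertian operator $\Box=\frac{\partial^2}{\partial t^2}-\sum_{i=1}^{3}\frac{\partial^2}{\partial x_i^2}$, where $x=(x_1,x_2,x_3)\in\mathbb{R}^3$ and $t$ is time. For $(x^0,t_0)\in\mathbb{R}^3\times\mathbb{R}$, the forward and backward cones are $$\Gamma^+(x^0,t_0)=\{(x,t): |x-x^0|\le t-t_0,\ t\ge 0\},\qquad \Gamma^-(x^0,t_0)=\{(x,t): |x-x^0|\le t_0-t,\ t\ge 0\}.$$ The support of $u$ is taken in $\mathbb{R}^3\times[0,\infty)$. The solution $u^0$ of the homogeneous wave equation with data $f=u(\cdot,0)$ and $g=u_t(\cdot,0)$ is the one given by Kirchhoff's formula $$u^0(x,t)=\frac{\partial}{\partial t}\left(\frac{t}{4\pi}\int_{|\xi|=1}f(x+t\xi)\,dS_\xi\right)+\frac{t}{4\pi}\int_{|\xi|=1}g(x+t\xi)\,dS_\xi,\qquad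 t\ge 0.$$ *)

theory Defs
  imports "HOL-Analysis.Analysis"
begin

type_synonym spacetime = "(real^3) \<times> real"

definition half_space :: "spacetime set" where
  "half_space = UNIV \<times> {0..}"

(* On a convex set with nonempty interior, such as half_space, derivatives within the set are
   unique, so Du and D2u are the one-sided first and second derivatives at boundary points.
   The first derivative takes values in the bounded linear maps with the operator norm. *)
definition C2_on :: "'a::euclidean_space set \<Rightarrow> ('a \<Rightarrow> real) \<Rightarrow> bool" where
  "C2_on S u \<longleftrightarrow>
     (\<exists>(Du :: 'a \<Rightarrow> 'a \<Rightarrow>\<^sub>L real) (D2u :: 'a \<Rightarrow> 'a \<Rightarrow>\<^sub>L ('a \<Rightarrow>\<^sub>L real)).
        (\<forall>z\<in>S. (u has_derivative blinfun_apply (Du z)) (at z within S)) \<and>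
        (\<forall>z\<in>S. (Du has_derivative blinfun_apply (D2u z)) (at z within S)) \<and>
        continuous_on S D2u)"

(* One-sided at t = 0, the ordinary partial derivative for t > 0. *)
definition partial_t :: "(spacetime \<Rightarrow> real) \<Rightarrow> spacetime \<Rightarrow> real" where
  "partial_t u = (\<lambda>(x, t). vector_derivative (\<lambda>s. u (x, s)) (at t within {0..}))"

definition partial_x :: "3 \<Rightarrow> (spacetime \<Rightarrow> real) \<Rightarrow> spacetime \<Rightarrow> real" where
  "partial_x i u = (\<lambda>(x, t). deriv (\<lambda>s. u (x + s *\<^sub>R axis i 1, t)) 0)"

definition dAlembertian :: "(spacetime \<Rightarrow> real) \<Rightarrow> spacetime \<Rightarrow> real" where
  "dAlembertian u z =
     partial_t (partial_t u) z - (\<Sum>i\<in>UNIV. partial_x i (partial_x i u) z)"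

definition forward_cone :: "real^3 \<Rightarrow> real \<Rightarrow> spacetime set" where
  "forward_cone x0 t0 = {(x, t). norm (x - x0) \<le> t - t0 \<and> t \<ge> 0}"

definition backward_cone :: "real^3 \<Rightarrow> real \<Rightarrow> spacetime set" where
  "backward_cone x0 t0 = {(x, t). norm (x - x0) \<le> t0 - t \<and> t \<ge> 0}"

(* As half_space is closed, the closure in half_space is the closure in the whole spacetime. *)
definition supp :: "(spacetime \<Rightarrow> real) \<Rightarrow> spacetime set" where
  "supp u = closure {z \<in> half_space. u z \<noteq> 0}"

definition sphere_param :: "real \<Rightarrow> real \<Rightarrow> real^3" where
  "sphere_param \<theta> \<phi> = vector [sin \<theta> * cos \<phi>, sin \<theta> * sin \<phi>, cos \<theta>]"

(* Surface integral over the unit sphere of R^3; the area element of sphere_param is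
   sin \<theta> d\<theta> d\<phi>. *)
definition sphere_integral :: "(real^3 \<Rightarrow> real) \<Rightarrow> real" where
  "sphere_integral h =
     integral (cbox (0, 0) (pi, 2 * pi)) (\<lambda>(\<theta>, \<phi>). h (sphere_param \<theta> \<phi>) * sin \<theta>)"

(* Kirchhoff's formula for the homogeneous wave equation with data f, g at t = 0. For f of
   class C^2 and g of class C^1 the result need not be C^2, so the free solution is taken to be
   the function given by this formula. *)
definition kirchhoff :: "(real^3 \<Rightarrow> real) \<Rightarrow> (real^3 \<Rightarrow> real) \<Rightarrow> spacetime \<Rightarrow> real" where
  "kirchhoff f g = (\<lambda>(x, t).
     partial_t (\<lambda>(y, s). s / (4 * pi) * sphere_integral (\<lambda>\<xi>. f (y + s *\<^sub>R \<xi>))) (x, t)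
     + t / (4 * pi) * sphere_integral (\<lambda>\<xi>. g (x + t *\<^sub>R \<xi>)))"

definition free_solution :: "(spacetime \<Rightarrow> real) \<Rightarrow> spacetime \<Rightarrow> real" where
  "free_solution u = kirchhoff (\<lambda>x. u (x, 0)) (\<lambda>x. partial_t u (x, 0))"

end

theory Submission
  imports Defs
begin

text \<open>
  Write \<open>M\<close> for the mean over the unit sphere. For \<open>u\<close> of class \<open>C\<^sup>2\<close>, the function
  \<open>Q s = M (u + s Du (\<xi>, 1))\<close>, evaluated at the points \<open>(x + s \<xi>, t - s)\<close> of the backward light cone,
  interpolates between \<open>u (x, t)\<close> at \<open>s = 0\<close> and Kirchhoff's free solution at \<open>s = t\<close>, and
  \<open>Q' s = - s M (\<box>u)\<close>. Hence in the forward cone \<open>u\<close> dominates the retarded potential of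
  \<open>A |u|\<^sup>p\<close>.

  If \<open>u\<close> does not vanish at some point outside the backward cone, this potential makes \<open>u\<close> positive at a
  point \<open>(x\<^sub>0, T)\<close> above the apex. Put \<open>r = |x - x\<^sub>0|\<close> and \<open>\<theta> = t - T\<close>. The potential of a
  neighbourhood of that point gives \<open>u \<ge> c / r\<close> in a shell around \<open>r = \<theta>\<close>, and the potential of the
  shell gives \<open>u \<ge> C \<theta>\<^bsup>1 - p\<^esup>\<close> in a shifted cone \<open>r \<le> \<theta> - b\<close>. From a bound
  \<open>u \<ge> C \<sigma>\<^sup>a \<theta>\<^bsup>- d\<^esup>\<close> with \<open>\<sigma> = (\<theta> - b)\<^sup>2 - r\<^sup>2\<close> one gets a bound with the exponents
  \<open>p a + 2\<close> and \<open>p d + 2\<close>. Iterating from \<open>a = 1\<close>, \<open>d = p + 1\<close>, the total power \<open>2 a - d\<close> of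
  \<open>\<theta>\<close> grows like \<open>p\<^sup>n (2 / (p - 1) - (p - 1))\<close>. The bracket is positive exactly when
  \<open>p < 1 + sqrt 2\<close>, and then the bounds are unbounded at a fixed point with large \<open>\<theta>\<close>.
\<close>

section \<open>Spherical means\<close>

definition sphere_mean :: "(real^3 \<Rightarrow> real) \<Rightarrow> real" where
  "sphere_mean h = sphere_integral h / (4 * pi)"

text \<open>The standard basis form opens the parametrisation to the termwise rules for continuity,
  derivatives and bilinear maps.\<close>

lemma sphere_param_eq:
  "sphere_param \<theta> \<phi> =
     (sin \<theta> * cos \<phi>) *\<^sub>R axis 1 1 + (sin \<theta> * sin \<phi>) *\<^sub>R axis 2 1 + cos \<theta> *\<^sub>R axis 3 1"
  by (simp add: sphere_param_def vec_eq_iff forall_3 axis_def)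

lemma norm_sphere_param [simp]: "norm (sphere_param \<theta> \<phi>) = 1"
proof -
  have "(sin \<theta> * cos \<phi>)\<^sup>2 + (sin \<theta> * sin \<phi>)\<^sup>2 + (cos \<theta>)\<^sup>2
      = (sin \<theta>)\<^sup>2 * ((sin \<phi>)\<^sup>2 + (cos \<phi>)\<^sup>2) + (cos \<theta>)\<^sup>2"
    by algebra
  then have "(sin \<theta> * cos \<phi>)\<^sup>2 + (sin \<theta> * sin \<phi>)\<^sup>2 + (cos \<theta>)\<^sup>2 = 1"
    by simp
  then show ?thesis
    by (simp add: sphere_param_def norm_eq_sqrt_inner inner_vec_def sum_3 power2_eq_square)
qed

lemma continuous_on_sphere_param [continuous_intros]:
  fixes f g :: "'a::t2_space \<Rightarrow> real"
  shows "continuous_on S f \<Longrightarrow> continuous_on S g \<Longrightarrow> continuous_on S (\<lambda>x. sphere_param (f x) (g x))"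
  unfolding sphere_param_eq by (intro continuous_intros)

abbreviation sphere_box :: "(real \<times> real) set" where
  "sphere_box \<equiv> cbox (0, 0) (pi, 2 * pi)"

lemma sin_nonneg_sphere_box: "z \<in> sphere_box \<Longrightarrow> 0 \<le> sin (fst z)"
  by (cases z) (auto simp: cbox_Pair_eq intro: sin_ge_zero)

lemma continuous_on_sphere_integrand:
  assumes "continuous_on (sphere 0 1) h"
  shows "continuous_on S (\<lambda>(\<theta>, \<phi>). h (sphere_param \<theta> \<phi>) * sin \<theta>)"
  unfolding case_prod_unfold
  by (intro continuous_intros continuous_on_compose2[OF assms]) auto

lemma integrable_sphere_integrand:
  assumes "continuous_on (sphere 0 1) h"
  shows "(\<lambda>(\<theta>, \<phi>). h (sphere_param \<theta> \<phi>) * sin \<theta>) integrable_on sphere_box"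
  using continuous_on_sphere_integrand[OF assms] by (intro integrable_continuous)

lemma sphere_mean_mono:
  assumes "continuous_on (sphere 0 1) f" "continuous_on (sphere 0 1) g"
    and "\<And>\<xi>. norm \<xi> = 1 \<Longrightarrow> f \<xi> \<le> g \<xi>"
  shows "sphere_mean f \<le> sphere_mean g"
  unfolding sphere_mean_def sphere_integral_def
  using assms sin_nonneg_sphere_box
  by (intro divide_right_mono integral_le integrable_sphere_integrand)
     (auto intro!: mult_right_mono)

lemma sphere_mean_cong:
  assumes "\<And>\<xi>. norm \<xi> = 1 \<Longrightarrow> f \<xi> = g \<xi>"
  shows "sphere_mean f = sphere_mean g"
  unfolding sphere_mean_def sphere_integral_def using assms by simp

lemma sphere_mean_add:
  assumes "continuous_on (sphere 0 1) f" "continuous_on (sphere 0 1) g"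
  shows "sphere_mean (\<lambda>\<xi>. f \<xi> + g \<xi>) = sphere_mean f + sphere_mean g"
  using integral_add[OF assms[THEN integrable_sphere_integrand]]
  by (simp add: sphere_mean_def sphere_integral_def case_prod_unfold distrib_right add_divide_distrib)

lemma sphere_mean_cmult: "sphere_mean (\<lambda>\<xi>. c * h \<xi>) = c * sphere_mean h"
  unfolding sphere_mean_def sphere_integral_def case_prod_unfold
  by (simp add: mult.assoc)

lemma sphere_mean_const [simp]: "sphere_mean (\<lambda>_. c) = c"
proof -
  have i: "integral {0..pi} sin = 2"
    using integral_unique[OF fundamental_theorem_of_calculus[of 0 pi "\<lambda>x. - cos x" sin]]
    by (auto intro!: derivative_eq_intros simp: has_real_derivative_iff_has_vector_derivative[symmetric])
  have "integral sphere_box (\<lambda>(\<theta>, \<phi>). c * sin \<theta>) =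
      integral (cbox 0 pi) (\<lambda>\<theta>. integral (cbox 0 (2 * pi)) (\<lambda>\<phi>. c * sin \<theta>))"
    by (subst integral_prod_continuous) (auto intro!: continuous_intros simp: case_prod_unfold)
  also have "\<dots> = c * (4 * pi)" by (simp add: i mult.assoc)
  finally show ?thesis by (simp add: sphere_mean_def sphere_integral_def)
qed

text \<open>If \<open>a\<close> is \<open>sin \<theta>\<close> times the polar component and \<open>b\<close> the azimuthal component of a tangential
  field, then \<open>a' + b'\<close> is \<open>sin \<theta>\<close> times its surface divergence.\<close>
lemma integral_sphere_divergence:
  fixes a b a' b' :: "real \<Rightarrow> real \<Rightarrow> real"
  assumes "\<And>\<theta> \<phi>. ((\<lambda>\<theta>. a \<theta> \<phi>) has_real_derivative a' \<theta> \<phi>) (at \<theta>)"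
    and "\<And>\<theta> \<phi>. ((\<lambda>\<phi>. b \<theta> \<phi>) has_real_derivative b' \<theta> \<phi>) (at \<phi>)"
    and a: "\<And>\<phi>. a 0 \<phi> = a pi \<phi>" and b: "\<And>\<theta>. b \<theta> 0 = b \<theta> (2 * pi)"
    and ca: "continuous_on UNIV (\<lambda>z. a' (fst z) (snd z))"
    and cb: "continuous_on UNIV (\<lambda>z. b' (fst z) (snd z))"
  shows "integral sphere_box (\<lambda>(\<theta>, \<phi>). a' \<theta> \<phi> + b' \<theta> \<phi>) = 0"
proof -
  have ca': "continuous_on sphere_box (\<lambda>(\<theta>, \<phi>). a' \<theta> \<phi>)" 
   and cb': "continuous_on sphere_box (\<lambda>(\<theta>, \<phi>). b' \<theta> \<phi>)"
    unfolding case_prod_unfold using ca cb continuous_on_subset by blast+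
  have ia: "integral (cbox 0 pi) (\<lambda>\<theta>. a' \<theta> \<phi>) = 0" for \<phi>
    using integral_unique[OF fundamental_theorem_of_calculus[of 0 pi "\<lambda>\<theta>. a \<theta> \<phi>" "\<lambda>\<theta>. a' \<theta> \<phi>"]] assms(1) a
    by (auto intro: has_vector_derivative_at_within simp: has_real_derivative_iff_has_vector_derivative)
  have ib: "integral (cbox 0 (2*pi)) (\<lambda>\<phi>. b' \<theta> \<phi>) = 0" for \<theta>
    using integral_unique[OF fundamental_theorem_of_calculus[of 0 "2*pi" "\<lambda>\<phi>. b \<theta> \<phi>" "\<lambda>\<phi>. b' \<theta> \<phi>"]]
        assms(2) b
    by (auto intro: has_vector_derivative_at_within simp: has_real_derivative_iff_has_vector_derivative)
  \<comment> \<open>Fubini is applied in opposite orders: \<open>a'\<close> is integrated over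
    \<theta> first, where \<open>a\<close> has equal end values, and \<open>b'\<close> over \<phi>
    first, where \<open>b\<close> has equal end values.\<close>
  have "integral sphere_box (\<lambda>(\<theta>, \<phi>). a' \<theta> \<phi>) = 0"
    using integral_prod_continuous[OF ca'] integral_swap_continuous[OF ca'] ia by simp
  moreover have "integral sphere_box (\<lambda>(\<theta>, \<phi>). b' \<theta> \<phi>) = 0"
    using integral_prod_continuous[OF cb'] ib by simp
  ultimately show ?thesis
    using integral_add[OF integrable_continuous[OF ca'] integrable_continuous[OF cb']]
    by (simp add: case_prod_unfold)
qed

section \<open>Kirchhoff's formula\<close>

text \<open>Together with \<open>azimuthal_tangent\<close> and the radial vector
  \<open>sphere_param\<close> this is the orthonormal frame of spherical coordinates.\<close>

definition polar_tangent :: "real \<Rightarrow> real \<Rightarrow> real^3" where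
  "polar_tangent \<theta> \<phi> =
     (cos \<theta> * cos \<phi>) *\<^sub>R axis 1 1 + (cos \<theta> * sin \<phi>) *\<^sub>R axis 2 1 - sin \<theta> *\<^sub>R axis 3 1"

definition azimuthal_tangent :: "real \<Rightarrow> real^3" where
  "azimuthal_tangent \<phi> = (- sin \<phi>) *\<^sub>R axis 1 1 + cos \<phi> *\<^sub>R axis 2 1"

lemma continuous_on_tangents [continuous_intros]:
  fixes f g :: "'a::t2_space \<Rightarrow> real"
  assumes "continuous_on S f" "continuous_on S g"
  shows "continuous_on S (\<lambda>x. polar_tangent (f x) (g x))"
    and "continuous_on S (\<lambda>x. azimuthal_tangent (f x))"
  unfolding polar_tangent_def azimuthal_tangent_def using assms by (intro continuous_intros; simp)+

lemma frame_derivatives: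
  "((\<lambda>\<theta>. sphere_param \<theta> \<phi>) has_vector_derivative polar_tangent \<theta> \<phi>) (at \<theta>)"
  "((\<lambda>\<theta>. polar_tangent \<theta> \<phi>) has_vector_derivative - sphere_param \<theta> \<phi>) (at \<theta>)"
  "((\<lambda>\<phi>. sphere_param \<theta> \<phi>) has_vector_derivative sin \<theta> *\<^sub>R azimuthal_tangent \<phi>) (at \<phi>)"
  "(azimuthal_tangent has_vector_derivative
     - (sin \<theta> *\<^sub>R sphere_param \<theta> \<phi> + cos \<theta> *\<^sub>R polar_tangent \<theta> \<phi>)) (at \<phi>)"
proof -
  show "((\<lambda>\<theta>. sphere_param \<theta> \<phi>) has_vector_derivative polar_tangent \<theta> \<phi>) (at \<theta>)"
    unfolding sphere_param_eq polar_tangent_def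
    by (auto intro!: derivative_eq_intros simp: algebra_simps)
  show "((\<lambda>\<theta>. polar_tangent \<theta> \<phi>) has_vector_derivative - sphere_param \<theta> \<phi>) (at \<theta>)"
    unfolding sphere_param_eq polar_tangent_def
    by (auto intro!: derivative_eq_intros simp: algebra_simps)
  show "((\<lambda>\<phi>. sphere_param \<theta> \<phi>) has_vector_derivative sin \<theta> *\<^sub>R azimuthal_tangent \<phi>) (at \<phi>)"
    unfolding sphere_param_eq azimuthal_tangent_def
    by (auto intro!: derivative_eq_intros simp: algebra_simps)
  \<comment> \<open>The vertical parts cancel, and the Pythagorean identity leaves the horizontal
    unit vector at angle \<phi>, whose negative is the derivative of
    \<open>azimuthal_tangent\<close>.\<close>
  have "s *\<^sub>R ((s * c) *\<^sub>R a + (s * d) *\<^sub>R b + k *\<^sub>R e) + k *\<^sub>R ((k * c) *\<^sub>R a + (k * d) *\<^sub>R b - s *\<^sub>R e)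
      = (s\<^sup>2 + k\<^sup>2) *\<^sub>R (c *\<^sub>R a + d *\<^sub>R b)" for s c d k :: real and a b e :: "real^3"
    by (simp add: algebra_simps power2_eq_square)
  from this[of "sin \<theta>" "cos \<phi>" _ "sin \<phi>" _ "cos \<theta>"]
  have "sin \<theta> *\<^sub>R sphere_param \<theta> \<phi> + cos \<theta> *\<^sub>R polar_tangent \<theta> \<phi>
      = cos \<phi> *\<^sub>R axis 1 1 + sin \<phi> *\<^sub>R axis 2 1"
    unfolding sphere_param_eq polar_tangent_def by simp
  then show "(azimuthal_tangent has_vector_derivative
     - (sin \<theta> *\<^sub>R sphere_param \<theta> \<phi> + cos \<theta> *\<^sub>R polar_tangent \<theta> \<phi>)) (at \<phi>)"
    unfolding azimuthal_tangent_def [abs_def]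
    by (auto intro!: derivative_eq_intros simp: algebra_simps)
qed

text \<open>The trace of a bilinear form is the same in every orthonormal basis. For this frame the
  expansion in coordinates and the Pythagorean identities suffice.\<close>

lemma frame_trace:
  fixes B :: "real^3 \<Rightarrow> real^3 \<Rightarrow> real"
  assumes "bilinear B"
  shows "B (sphere_param \<theta> \<phi>) (sphere_param \<theta> \<phi>) + B (polar_tangent \<theta> \<phi>) (polar_tangent \<theta> \<phi>)
      + B (azimuthal_tangent \<phi>) (azimuthal_tangent \<phi>) = (\<Sum>i\<in>UNIV. B (axis i 1) (axis i 1))"
proof -
  have sc: "(sin \<theta>)\<^sup>2 = 1 - (cos \<theta>)\<^sup>2" "(sin \<phi>)\<^sup>2 = 1 - (cos \<phi>)\<^sup>2"
    by (simp_all add: sin_squared_eq)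
  show ?thesis
    unfolding sphere_param_eq polar_tangent_def azimuthal_tangent_def sum_3
    by (simp only: bilinear_ladd[OF assms] bilinear_radd[OF assms] bilinear_lsub[OF assms]
        bilinear_rsub[OF assms] bilinear_lmul[OF assms] bilinear_rmul[OF assms] real_scaleR_def)
      (use sc in algebra)
qed

section \<open>Functions of class C^2 up to the boundary t = 0\<close>

locale C2_half_space =
  fixes u :: "spacetime \<Rightarrow> real"
    and Du :: "spacetime \<Rightarrow> spacetime \<Rightarrow>\<^sub>L real"
    and D2u :: "spacetime \<Rightarrow> spacetime \<Rightarrow>\<^sub>L (spacetime \<Rightarrow>\<^sub>L real)"
  assumes deriv_u: "z \<in> half_space \<Longrightarrow> (u has_derivative blinfun_apply (Du z)) (at z within half_space)"
    and deriv_Du: "z \<in> half_space \<Longrightarrow> (Du has_derivative blinfun_apply (D2u z)) (at z within half_space)"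
    and continuous_D2u: "continuous_on half_space D2u"
begin

lemma continuous_Du: "continuous_on half_space Du"
  and continuous_u: "continuous_on half_space u"
  unfolding continuous_on_eq_continuous_within
  by (blast intro: has_derivative_continuous deriv_u deriv_Du)+

lemma continuous_on_half_space [continuous_intros]:
  assumes "continuous_on S f" "f ` S \<subseteq> half_space"
  shows "continuous_on S (\<lambda>x. u (f x))" "continuous_on S (\<lambda>x. Du (f x))" "continuous_on S (\<lambda>x. D2u (f x))"
  using continuous_on_compose2 continuous_u continuous_Du continuous_D2u assms by blast+

text \<open>The chain rule for curves in the half space, relative to a set \<open>S\<close> so that
  one-sided derivatives are covered. Later derivatives of \<open>u\<close> and \<open>Du\<close> are
  reduced to it by a choice of \<open>g\<close> and \<open>w\<close>.\<close>

lemma deriv_along_path: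
  assumes g: "(g has_vector_derivative g') (at s within S)" "g ` S \<subseteq> half_space" "s \<in> S"
  shows "((\<lambda>s. u (g s)) has_real_derivative Du (g s) g') (at s within S)"
    and "(w has_vector_derivative w') (at s within S) \<Longrightarrow>
      ((\<lambda>s. Du (g s) (w s)) has_real_derivative D2u (g s) g' (w s) + Du (g s) w') (at s within S)"
proof -
  have gs: "g s \<in> half_space" using assms by auto
  have "((u \<circ> g) has_vector_derivative Du (g s) g') (at s within S)"
    by (rule vector_derivative_diff_chain_within[OF g(1)])
       (rule has_derivative_subset[OF deriv_u[OF gs] g(2)])
  then show "((\<lambda>s. u (g s)) has_real_derivative Du (g s) g') (at s within S)"
    by (simp add: has_real_derivative_iff_has_vector_derivative o_def)
  assume w: "(w has_vector_derivative w') (at s within S)"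
  have "((Du \<circ> g) has_vector_derivative D2u (g s) g') (at s within S)"
    by (rule vector_derivative_diff_chain_within[OF g(1)])
       (rule has_derivative_subset[OF deriv_Du[OF gs] g(2)])
  then have "((\<lambda>s. Du (g s) (w s)) has_vector_derivative Du (g s) w' + D2u (g s) g' (w s)) (at s within S)"
    using w by (intro bounded_bilinear.has_vector_derivative[OF bounded_bilinear_blinfun_apply])
        (auto simp: o_def)
  then show "((\<lambda>s. Du (g s) (w s)) has_real_derivative D2u (g s) g' (w s) + Du (g s) w') (at s within S)"
    by (simp add: has_real_derivative_iff_has_vector_derivative add.commute)
qed

text \<open>Directions v tangential to the boundary and w pointing into the half space keep the whole
  parallelogram inside it.\<close>
lemma D2u_symmetric:
  assumes z: "z \<in> half_space" and v: "snd v = 0" and w: "snd w \<ge> 0"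
  shows "D2u z v w = D2u z w v"
proof -
  have lp: "at (0::real) within {0..1} \<noteq> bot"
    using connected_imp_perfect[of "{0..1::real}" 0] by (auto simp: trivial_limit_within)
  have mem: "z + s *\<^sub>R v + r *\<^sub>R w \<in> half_space" if "r \<ge> 0" for r s
    using z v w that by (auto simp: half_space_def mem_Times_iff)
  have d1: "((\<lambda>s. u (z + s *\<^sub>R v + r *\<^sub>R w)) has_real_derivative Du (z + s *\<^sub>R v + r *\<^sub>R w) v)
      (at s within S)"
    if "r \<ge> 0" "s \<in> S" for r s S
    by (rule deriv_along_path(1)) (use that mem in \<open>auto intro!: derivative_eq_intros\<close>)
  have d2: "((\<lambda>r. u (z + s *\<^sub>R v + r *\<^sub>R w)) has_real_derivative Du (z + s *\<^sub>R v + r *\<^sub>R w) w)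
      (at r within {0..1})"
    if "r \<in> {0..1}" for r s
    by (rule deriv_along_path(1)) (use that mem in \<open>auto intro!: derivative_eq_intros\<close>)
  have I: "integral (cbox 0 s) (\<lambda>\<sigma>. Du (z + \<sigma> *\<^sub>R v + r *\<^sub>R w) v) = u (z + s *\<^sub>R v + r *\<^sub>R w) - u (z
      + r *\<^sub>R w)"
    if "r \<ge> 0" "s \<ge> 0" for r s
    using fundamental_theorem_of_calculus[of 0 s "\<lambda>s. u (z + s *\<^sub>R v + r *\<^sub>R w)" "\<lambda>s. Du (z
        + s *\<^sub>R v + r *\<^sub>R w) v"] that d1
    by (auto simp: has_real_derivative_iff_has_vector_derivative intro!: integral_unique)
  \<comment> \<open>Differentiation under the integral sign at r = 0, from the right only, since
    \<open>z + r *\<^sub>R w\<close> may leave the half space for negative r.\<close>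
  have L: "((\<lambda>r. integral (cbox 0 s) (\<lambda>\<sigma>. Du (z + \<sigma> *\<^sub>R v + r *\<^sub>R w) v)) has_real_derivative
      integral (cbox 0 s) (\<lambda>\<sigma>. D2u (z + \<sigma> *\<^sub>R v + 0 *\<^sub>R w) w v)) (at 0 within {0..1})" for s
  proof (rule leibniz_rule_field_derivative)
    fix r \<sigma> :: real assume r: "r \<in> {0..1}"
    have "((\<lambda>r. Du (z + \<sigma> *\<^sub>R v + r *\<^sub>R w) v) has_real_derivative D2u (z + \<sigma> *\<^sub>R v + r *\<^sub>R w) w v
        + Du (z + \<sigma> *\<^sub>R v + r *\<^sub>R w) 0) (at r within {0..1})"
      by (rule deriv_along_path(2)) (use r mem in \<open>auto intro!: derivative_eq_intros\<close>)
    then show "((\<lambda>r. Du (z + \<sigma> *\<^sub>R v + r *\<^sub>R w) v) has_real_derivative D2u (z + \<sigma> *\<^sub>R v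
        + r *\<^sub>R w) w v) (at r within {0..1})"
      by simp
  next
    show "(\<lambda>\<sigma>. Du (z + \<sigma> *\<^sub>R v + r *\<^sub>R w) v) integrable_on cbox 0 s" if "r \<in> {0..1}" for r
      using that mem by (intro integrable_continuous continuous_intros) auto
  next
    show "continuous_on ({0..1} \<times> cbox 0 s) (\<lambda>(r, \<sigma>). D2u (z + \<sigma> *\<^sub>R v + r *\<^sub>R w) w v)"
      unfolding case_prod_unfold using mem by (intro continuous_intros) auto
  qed auto
  \<comment> \<open>The r-derivative at 0 of \<open>u (z + s *\<^sub>R v + r *\<^sub>R w) - u (z + r
    *\<^sub>R w)\<close> is computed twice, under the integral and directly. Differentiating the
    resulting identity in s at 0 yields the symmetry.\<close>
  have eq: "integral (cbox 0 s) (\<lambda>\<sigma>. D2u (z + \<sigma> *\<^sub>R v) w v) = Du (z + s *\<^sub>R v) w - Du z w"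
      if s: "s \<in> {0..1}" for s
  proof -
    have A: "((\<lambda>r. u (z + s *\<^sub>R v + r *\<^sub>R w) - u (z + 0 *\<^sub>R v + r *\<^sub>R w)) has_real_derivative
        Du (z + s *\<^sub>R v + 0 *\<^sub>R w) w - Du (z + 0 *\<^sub>R v + 0 *\<^sub>R w) w) (at 0 within {0..1})"
      by (intro derivative_intros d2) auto
    have "((\<lambda>r. u (z + s *\<^sub>R v + r *\<^sub>R w) - u (z + 0 *\<^sub>R v + r *\<^sub>R w)) has_real_derivative
        integral (cbox 0 s) (\<lambda>\<sigma>. D2u (z + \<sigma> *\<^sub>R v) w v)) (at 0 within {0..1})"
      by (rule has_field_derivative_transform_within[OF L[of s, unfolded scaleR_zero_left
          add_0_right], of 1]) (use s I in auto)
    then show ?thesis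
      using A has_field_derivative_unique[OF _ _ lp] by auto
  qed
  have c: "continuous_on {0..1} (\<lambda>\<sigma>. D2u (z + \<sigma> *\<^sub>R v) w v)"
    using mem[of 0] by (intro continuous_intros) auto
  have "((\<lambda>s. integral {0..s} (\<lambda>\<sigma>. D2u (z + \<sigma> *\<^sub>R v) w v)) has_real_derivative D2u (z
      + 0 *\<^sub>R v) w v) (at 0 within {0..1})"
    by (rule integral_has_real_derivative[OF c]) auto
  then have "((\<lambda>s. Du (z + s *\<^sub>R v) w - Du z w) has_real_derivative D2u (z + 0 *\<^sub>R v) w v)
      (at 0 within {0..1})"
    by (rule has_field_derivative_transform_within[where d=1]) (use eq in auto)
  moreover have "((\<lambda>s. Du (z + s *\<^sub>R v) w) has_real_derivative D2u (z + 0 *\<^sub>R v) v w + Du (z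
      + 0 *\<^sub>R v) 0) (at 0 within {0..1})"
    by (rule deriv_along_path(2)) (use mem[of 0] in \<open>auto intro!: derivative_eq_intros\<close>)
  then have "((\<lambda>s. Du (z + s *\<^sub>R v) w - Du z w) has_real_derivative D2u (z + 0 *\<^sub>R v) v w + Du (z
      + 0 *\<^sub>R v) 0 - 0) (at 0 within {0..1})"
    by (intro derivative_intros)
  ultimately show ?thesis
    using has_field_derivative_unique[OF _ _ lp] by (auto simp: blinfun.zero_right)
qed

end

text \<open>Derivatives are taken within a convex set \<open>U\<close>, so that the ends of
  \<open>{0..t}\<close> and the initial time 0 are included.\<close>

lemma sphere_mean_leibniz:
  fixes F F' :: "real \<Rightarrow> real^3 \<Rightarrow> real"
  assumes d: "\<And>s \<xi>. s \<in> U \<Longrightarrow> norm \<xi> = 1 \<Longrightarrow> ((\<lambda>s. F s \<xi>) has_real_derivative F' s \<xi>) (at s within U)"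
    and c: "\<And>s. s \<in> U \<Longrightarrow> continuous_on (sphere 0 1) (F s)"
    and c': "continuous_on (U \<times> sphere 0 1) (\<lambda>z. F' (fst z) (snd z))"
    and "convex U" "s \<in> U"
  shows "((\<lambda>s. sphere_mean (F s)) has_real_derivative sphere_mean (F' s)) (at s within U)"
  unfolding sphere_mean_def sphere_integral_def
proof (intro DERIV_cdivide leibniz_rule_field_derivative)
  fix s z assume "s \<in> U"
  then show "((\<lambda>s. case z of (\<theta>, \<phi>) \<Rightarrow> F s (sphere_param \<theta> \<phi>) * sin \<theta>) has_real_derivative
      (case z of (\<theta>, \<phi>) \<Rightarrow> F' s (sphere_param \<theta> \<phi>) * sin \<theta>)) (at s within U)"
    by (auto simp: case_prod_unfold intro!: DERIV_cmult_right d)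
next
  have "continuous_on (U \<times> sphere_box) (\<lambda>w. F' (fst w) (sphere_param (fst (snd w)) (snd (snd w))) *
      sin (fst (snd w)))"
    by (intro continuous_intros continuous_on_compose2[OF c', of _ "\<lambda>w. (fst w, sphere_param (fst
        (snd w)) (snd (snd w)))", simplified]) auto
  then show "continuous_on (U \<times> sphere_box) (\<lambda>(s, z). case z of (\<theta>, \<phi>) \<Rightarrow> F' s (sphere_param \<theta> \<phi>) * sin \<theta>)"
    by (simp add: case_prod_unfold)
qed (use assms in \<open>auto intro: integrable_sphere_integrand\<close>)

lemma at_within_Ici_neq_bot:
  fixes a t :: real
  assumes "a \<le> t"
  shows "at t within {a..} \<noteq> bot"
proof -
  have "{a..} \<noteq> {x}" for x
  proof
    assume "{a..} = {x}"
    then have "a \<in> {x}" "a + 1 \<in> {x}" by (metis atLeast_iff order_refl, metis atLeast_iff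
        less_add_one less_imp_le)
    then show False by simp
  qed
  then show ?thesis
    using connected_imp_perfect[of "{a..}" t] assms by (auto simp: trivial_limit_within)
qed

section \<open>Spherical means over the backward light cone\<close>

context C2_half_space
begin

lemma partial_t_eq: "t \<ge> 0 \<Longrightarrow> partial_t u (x, t) = Du (x, t) (0, 1)"
  unfolding partial_t_def prod.case
proof (rule vector_derivative_within)
  assume "t \<ge> 0"
  then show "at t within {0..} \<noteq> bot"
    by (rule at_within_Ici_neq_bot)
  show "((\<lambda>s. u (x, s)) has_vector_derivative Du (x, t) (0, 1)) (at t within {0..})"
    unfolding has_real_derivative_iff_has_vector_derivative[symmetric]
    by (rule deriv_along_path(1)) (use \<open>t \<ge> 0\<close> in \<open>auto simp: half_space_def intro!: derivative_eq_intros\<close>)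
qed

text \<open>The d'Alembertian read off from \<open>D2u\<close>; in this form it is visibly
  continuous up to t = 0.\<close>

definition wave_operator :: "spacetime \<Rightarrow> real" where
  "wave_operator z = D2u z (0, 1) (0, 1) - (\<Sum>i\<in>UNIV. D2u z (axis i 1, 0) (axis i 1, 0))"

lemma dAlembertian_eq:
  assumes "t > 0"
  shows "dAlembertian u (x, t) = wave_operator (x, t)"
proof -
  have nb: "at t within {0..} \<noteq> bot"
    using assms by (intro at_within_Ici_neq_bot) simp
  have "((\<lambda>s. Du (x, s) (0, 1)) has_real_derivative D2u (x, t) (0, 1) (0, 1) + Du (x, t) 0)
      (at t within {0..})"
    by (rule deriv_along_path(2)) (use assms in \<open>auto simp: half_space_def intro!: derivative_eq_intros\<close>)
  then have "((\<lambda>s. partial_t u (x, s)) has_real_derivative D2u (x, t) (0, 1) (0, 1) + Du (x, t) 0)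
      (at t within {0..})"
    by (rule has_field_derivative_transform_within[where d = 1]) (use assms partial_t_eq in auto)
  then have tt: "partial_t (partial_t u) (x, t) = D2u (x, t) (0, 1) (0, 1)"
    using vector_derivative_within[OF nb]
    by (simp add: has_real_derivative_iff_has_vector_derivative partial_t_def[of "partial_t u"]
        blinfun.zero_right)
  have px: "partial_x i u (y, t) = Du (y, t) (axis i 1, 0)" for i y
  proof -
    have "((\<lambda>s. u (y + s *\<^sub>R axis i 1, t)) has_real_derivative Du (y
        + 0 *\<^sub>R axis i 1, t) (axis i 1, 0)) (at 0)"
      by (rule deriv_along_path(1)) (use assms in \<open>auto simp: half_space_def intro!: derivative_eq_intros\<close>)
    then show ?thesis by (simp add: partial_x_def DERIV_imp_deriv)
  qed
  have "partial_x i (partial_x i u) (x, t) = D2u (x, t) (axis i 1, 0) (axis i 1, 0)" for i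
  proof -
    have "((\<lambda>s. Du (x + s *\<^sub>R axis i 1, t) (axis i 1, 0)) has_real_derivative
        D2u (x + 0 *\<^sub>R axis i 1, t) (axis i 1, 0) (axis i 1, 0) + Du (x + 0 *\<^sub>R axis i 1, t) 0) (at 0)"
      by (rule deriv_along_path(2)) (use assms in \<open>auto simp: half_space_def intro!: derivative_eq_intros\<close>)
    then show ?thesis by (simp add: partial_x_def[of i "partial_x i u"] px DERIV_imp_deriv
        blinfun.zero_right)
  qed
  then show ?thesis by (simp add: dAlembertian_def wave_operator_def tt)
qed

text \<open>The function \<open>Q\<close> of the introduction. The integrand is the derivative at h
  = 0 of s + h times the value of \<open>u\<close> at the point moved by h in the null direction
  (\<xi>, 1), whereas increasing s moves the point itself in direction (\<xi>, -1).\<close>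

definition cone_mean :: "real^3 \<Rightarrow> real \<Rightarrow> real \<Rightarrow> real" where
  "cone_mean x t s =
     sphere_mean (\<lambda>\<xi>. u (x + s *\<^sub>R \<xi>, t - s) + s * Du (x + s *\<^sub>R \<xi>, t - s) (\<xi>, 1))"

lemma cone_mean_0: "t \<ge> 0 \<Longrightarrow> cone_mean x t 0 = u (x, t)"
  by (simp add: cone_mean_def)

text \<open>Carrying out the time derivative in Kirchhoff's formula gives the mean of the data plus
  t times the mean of the radial derivative. With the velocity term this is the integrand at s = t,
  by the splitting (\<xi>, 1) = (\<xi>, 0) + (0, 1).\<close>

lemma cone_mean_initial:
  assumes "t \<ge> 0"
  shows "cone_mean x t t = free_solution u (x, t)"
proof -
  have nb: "at t within {0..} \<noteq> bot"
    using assms by (intro at_within_Ici_neq_bot) simp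
  have hs: "(y, 0) \<in> half_space" for y by (simp add: half_space_def)
  note ci = continuous_intros continuous_on_half_space
  let ?M = "\<lambda>s. sphere_mean (\<lambda>\<xi>. u (x + s *\<^sub>R \<xi>, 0))"
  have "(?M has_real_derivative sphere_mean (\<lambda>\<xi>. Du (x + t *\<^sub>R \<xi>, 0) (\<xi>, 0))) (at t within {0..})"
  proof (rule sphere_mean_leibniz)
    show "((\<lambda>s. u (x + s *\<^sub>R \<xi>, 0)) has_real_derivative Du (x + s *\<^sub>R \<xi>, 0) (\<xi>, 0)) (at s within {0..})"
      if "s \<in> {0..}" for s \<xi>
      by (rule deriv_along_path(1)) (use that hs in \<open>auto intro!: derivative_eq_intros\<close>)
  qed (use assms hs in \<open>auto intro!: ci\<close>)
  then have "((\<lambda>s. s * ?M s) has_real_derivative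
      ?M t + t * sphere_mean (\<lambda>\<xi>. Du (x + t *\<^sub>R \<xi>, 0) (\<xi>, 0))) (at t within {0..})"
    by (auto intro!: derivative_eq_intros)
  then have "partial_t (\<lambda>(y, s). s / (4 * pi) * sphere_integral (\<lambda>\<xi>. u (y + s *\<^sub>R \<xi>, 0))) (x, t)
      = ?M t + t * sphere_mean (\<lambda>\<xi>. Du (x + t *\<^sub>R \<xi>, 0) (\<xi>, 0))"
    using vector_derivative_within[OF nb]
    by (simp add: partial_t_def has_real_derivative_iff_has_vector_derivative sphere_mean_def)
  moreover have c: "continuous_on (sphere 0 1) (\<lambda>\<xi>. u (x + t *\<^sub>R \<xi>, 0))"
    "continuous_on (sphere 0 1) (\<lambda>\<xi>. t * Du (x + t *\<^sub>R \<xi>, 0) (\<xi>, 0))"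
    "continuous_on (sphere 0 1) (\<lambda>\<xi>. t * Du (x + t *\<^sub>R \<xi>, 0) (0, 1))"
    using hs by (auto intro!: ci)
  ultimately have "free_solution u (x, t) = ?M t + (t * sphere_mean (\<lambda>\<xi>. Du (x + t *\<^sub>R \<xi>, 0) (\<xi>, 0))
      + t * sphere_mean (\<lambda>\<xi>. Du (x + t *\<^sub>R \<xi>, 0) (0, 1)))"
    by (simp add: free_solution_def kirchhoff_def partial_t_eq sphere_mean_def)
  also have "\<dots> = ?M t + (sphere_mean (\<lambda>\<xi>. t * Du (x + t *\<^sub>R \<xi>, 0) (\<xi>, 0))
      + sphere_mean (\<lambda>\<xi>. t * Du (x + t *\<^sub>R \<xi>, 0) (0, 1)))"
    by (simp add: sphere_mean_cmult)
  also have "\<dots> = sphere_mean (\<lambda>\<xi>. u (x + t *\<^sub>R \<xi>, 0) + (t * Du (x + t *\<^sub>R \<xi>, 0) (\<xi>, 0) + t * Du (x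
      + t *\<^sub>R \<xi>, 0) (0, 1)))"
    using sphere_mean_add[OF c(1) continuous_on_add[OF c(2,3)]] sphere_mean_add[OF c(2,3)] by simp
  also have "\<dots> = cone_mean x t t"
    unfolding cone_mean_def
  proof (rule sphere_mean_cong)
    fix \<xi> :: "real^3"
    have e: "(\<xi>, 1 :: real) = (\<xi>, 0) + (0, 1)" by simp
    show "u (x + t *\<^sub>R \<xi>, 0) + (t * Du (x + t *\<^sub>R \<xi>, 0) (\<xi>, 0) + t * Du (x + t *\<^sub>R \<xi>, 0) (0, 1))
        = u (x + t *\<^sub>R \<xi>, t - t) + t * Du (x + t *\<^sub>R \<xi>, t - t) (\<xi>, 1)"
      unfolding e blinfun.add_right by (simp add: distrib_left)
  qed
  finally show ?thesis ..
qed

text \<open>The integrand is the surface divergence, in \<xi>, of the tangential part of the spatial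
  gradient at \<open>x + s *\<^sub>R \<xi>\<close>. The trace without its radial entry comes from
  differentiating the gradient, the term with factor 2 from the curvature of the sphere.\<close>

lemma sphere_mean_angular:
  fixes x :: "real^3"
  assumes s: "s \<in> {0..t}"
  defines "z \<equiv> \<lambda>\<xi>. (x + s *\<^sub>R \<xi>, t - s)"
  shows "sphere_mean (\<lambda>\<xi>. s * ((\<Sum>i\<in>UNIV. D2u (z \<xi>) (axis i 1, 0) (axis i 1, 0)) - D2u (z \<xi>) (\<xi>, 0) (\<xi>, 0))
      - 2 * Du (z \<xi>) (\<xi>, 0)) = 0"
proof -
  have hs: "z \<xi> \<in> half_space" for \<xi> using s by (simp add: half_space_def z_def)
  note ci = continuous_intros continuous_on_half_space
  define Z where "Z \<theta> \<phi> = z (sphere_param \<theta> \<phi>)" for \<theta> \<phi>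
  define a where "a \<theta> \<phi> = sin \<theta> * Du (Z \<theta> \<phi>) (polar_tangent \<theta> \<phi>, 0)" for \<theta> \<phi>
  define b where "b \<theta> \<phi> = Du (Z \<theta> \<phi>) (azimuthal_tangent \<phi>, 0)" for \<theta> \<phi>
  define a' where "a' \<theta> \<phi> = cos \<theta> * Du (Z \<theta> \<phi>) (polar_tangent \<theta> \<phi>, 0)
      + sin \<theta> * (D2u (Z \<theta> \<phi>) (s *\<^sub>R polar_tangent \<theta> \<phi>, 0) (polar_tangent \<theta> \<phi>, 0)
          + Du (Z \<theta> \<phi>) (- sphere_param \<theta> \<phi>, 0))" for \<theta> \<phi>
  define b' where "b' \<theta> \<phi> = D2u (Z \<theta> \<phi>) (s *\<^sub>R sin \<theta> *\<^sub>R azimuthal_tangent \<phi>, 0) (azimuthal_tangent \<phi>, 0)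
      + Du (Z \<theta> \<phi>) (- (sin \<theta> *\<^sub>R sphere_param \<theta> \<phi> + cos \<theta> *\<^sub>R polar_tangent \<theta> \<phi>), 0)" for \<theta> \<phi>
  have "integral sphere_box (\<lambda>(\<theta>, \<phi>). a' \<theta> \<phi> + b' \<theta> \<phi>) = 0"
  proof (rule integral_sphere_divergence)
    fix \<theta> \<phi>
    have "((\<lambda>\<theta>. Du (Z \<theta> \<phi>) (polar_tangent \<theta> \<phi>, 0)) has_real_derivative
        D2u (Z \<theta> \<phi>) (s *\<^sub>R polar_tangent \<theta> \<phi>, 0) (polar_tangent \<theta> \<phi>, 0)
            + Du (Z \<theta> \<phi>) (- sphere_param \<theta> \<phi>, 0)) (at \<theta>)"
      by (rule deriv_along_path(2))
         (use hs in \<open>auto simp: Z_def z_def intro!: derivative_eq_intros frame_derivatives\<close>)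
    then show "((\<lambda>\<theta>. a \<theta> \<phi>) has_real_derivative a' \<theta> \<phi>) (at \<theta>)"
      unfolding a_def a'_def by (auto intro!: derivative_eq_intros)
    show "((\<lambda>\<phi>. b \<theta> \<phi>) has_real_derivative b' \<theta> \<phi>) (at \<phi>)"
      unfolding b_def b'_def
      by (rule deriv_along_path(2))
         (use hs in \<open>auto simp: Z_def z_def intro!: derivative_eq_intros frame_derivatives\<close>)
    show "a 0 \<phi> = a pi \<phi>" by (simp add: a_def)
    show "b \<theta> 0 = b \<theta> (2 * pi)"
      by (simp add: b_def Z_def sphere_param_def azimuthal_tangent_def)
  next
    have cz: "continuous_on UNIV (\<lambda>w. Z (fst w) (snd w))"
      unfolding Z_def z_def by (intro ci)
    show "continuous_on UNIV (\<lambda>w. a' (fst w) (snd w))"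
      unfolding a'_def using hs cz by (intro ci) (auto simp: Z_def)
    show "continuous_on UNIV (\<lambda>w. b' (fst w) (snd w))"
      unfolding b'_def using hs cz by (intro ci) (auto simp: Z_def)
  qed
  \<comment> \<open>The terms with factor \<open>cos \<theta>\<close> cancel between
    \<open>a'\<close> and \<open>b'\<close>, each of which contributes one radial derivative;
    \<open>frame_trace\<close> turns the two tangential second derivatives into the trace minus the
    radial one.\<close>
  moreover have "a' \<theta> \<phi> + b' \<theta> \<phi> = (s * ((\<Sum>i\<in>UNIV. D2u (Z \<theta> \<phi>) (axis i 1, 0) (axis i 1, 0))
      - D2u (Z \<theta> \<phi>) (sphere_param \<theta> \<phi>, 0) (sphere_param \<theta> \<phi>, 0)) - 2 * Du (Z \<theta> \<phi>) (sphere_param \<theta> \<phi>,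
          0)) * sin \<theta>"
    for \<theta> \<phi>
  proof -
    define B where "B v w = D2u (Z \<theta> \<phi>) (v, 0) (w, 0)" for v w :: "real^3"
    define D where "D v = Du (Z \<theta> \<phi>) (v, 0)" for v :: "real^3"
    have lp: "linear (\<lambda>v::real^3. (v, 0::real))" by (auto intro!: linearI)
    have "linear D" unfolding D_def
      using linear_compose[OF lp, of "blinfun_apply (Du (Z \<theta> \<phi>))"] bounded_linear.linear[OF
          blinfun.bounded_linear_right]
      by (auto simp: o_def)
    have e: "(v + w, 0 :: real) = (v, 0) + (w, 0)" "(c *\<^sub>R v, 0 :: real) = c *\<^sub>R (v, 0)"
      for v w :: "real^3" and c by simp_all
    have B: "bilinear B"
      unfolding bilinear_def B_def by (auto intro!: linearI simp only: e blinfun.bilinear_simps)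
    show ?thesis
      unfolding a'_def b'_def B_def[symmetric] D_def[symmetric] frame_trace[OF B, of \<theta> \<phi>, symmetric]
          scaleR_scaleR
      by (simp add: bilinear_lmul[OF B] linear_add[OF \<open>linear D\<close>] linear_neg[OF \<open>linear D\<close>]
          linear_scale[OF \<open>linear D\<close>] linear_diff[OF \<open>linear D\<close>] algebra_simps)
  qed
  ultimately show ?thesis
    by (simp add: sphere_mean_def sphere_integral_def Z_def)
qed

text \<open>Differentiating along (\<xi>, -1) an expression that contains the derivative along
  (\<xi>, 1) makes the mixed derivatives cancel by symmetry. Apart from the wave operator only the
  negative of the integrand of \<open>sphere_mean_angular\<close> remains, and its mean is
  0.\<close>

lemma cone_mean_deriv:
  assumes s: "s \<in> {0..t}"
  shows "(cone_mean x t has_real_derivative - s * sphere_mean (\<lambda>\<xi>. wave_operator (x + s *\<^sub>R \<xi>, t - s)))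
    (at s within {0..t})"
proof -
  note ci = continuous_intros continuous_on_half_space
  have hs: "(x + s *\<^sub>R \<xi>, t - s) \<in> half_space" if "s \<in> {0..t}" for s \<xi>
    using that by (simp add: half_space_def)
  let ?z = "\<lambda>s \<xi>. (x + s *\<^sub>R \<xi>, t - s)"
  let ?F' = "\<lambda>s \<xi>. Du (?z s \<xi>) (\<xi>, -1) + (Du (?z s \<xi>) (\<xi>, 1) + s * (D2u (?z s \<xi>) (\<xi>, -1) (\<xi>, 1)
      + Du (?z s \<xi>) 0))"
  let ?A = "\<lambda>\<xi>. s * ((\<Sum>i\<in>UNIV. D2u (?z s \<xi>) (axis i 1, 0) (axis i 1, 0)) - D2u (?z s \<xi>) (\<xi>, 0) (\<xi>, 0))
      - 2 * Du (?z s \<xi>) (\<xi>, 0)"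
  have "(cone_mean x t has_real_derivative sphere_mean (?F' s)) (at s within {0..t})"
    unfolding cone_mean_def [abs_def]
  proof (rule sphere_mean_leibniz)
    show "((\<lambda>s. u (?z s \<xi>) + s * Du (?z s \<xi>) (\<xi>, 1)) has_real_derivative ?F' s \<xi>) (at s within {0..t})"
      if "s \<in> {0..t}" for s \<xi>
    proof -
      have g: "((\<lambda>s. ?z s \<xi>) has_vector_derivative (\<xi>, -1)) (at s within {0..t})"
        by (auto intro!: derivative_eq_intros)
      have m: "(\<lambda>s. ?z s \<xi>) ` {0..t} \<subseteq> half_space"
        using hs by auto
      show ?thesis
        using DERIV_add[OF deriv_along_path(1)[OF g m that]
          DERIV_mult[OF DERIV_ident deriv_along_path(2)[OF g m that has_vector_derivative_const[of
              "(\<xi>, 1)"]]]]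
        by (simp add: mult.commute add_ac)
    qed
    show "continuous_on ({0..t} \<times> sphere 0 1) (\<lambda>z. ?F' (fst z) (snd z))"
      using hs by (intro ci) auto
    show "continuous_on (sphere 0 1) (\<lambda>\<xi>. u (?z s \<xi>) + s * Du (?z s \<xi>) (\<xi>, 1))" if "s \<in> {0..t}" for s
      using hs[OF that] by (intro ci) auto
  qed (use s in auto)
  moreover have "?F' s \<xi> = - s * wave_operator (?z s \<xi>) + - 1 * ?A \<xi>" for \<xi>
  proof -
    have sym: "D2u (?z s \<xi>) (\<xi>, 0) (0, 1) = D2u (?z s \<xi>) (0, 1) (\<xi>, 0)"
      using s by (intro D2u_symmetric hs) auto
    have e: "(\<xi>, -1 :: real) = (\<xi>, 0) - (0, 1)" "(\<xi>, 1 :: real) = (\<xi>, 0) + (0, 1)"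
      by simp_all
    show ?thesis
      unfolding e wave_operator_def blinfun.bilinear_simps using sym
      by (simp add: algebra_simps)
  qed
  moreover have "sphere_mean (\<lambda>\<xi>. - s * wave_operator (?z s \<xi>) + - 1 * ?A \<xi>)
      = - s * sphere_mean (\<lambda>\<xi>. wave_operator (?z s \<xi>)) + - 1 * sphere_mean ?A"
    unfolding sphere_mean_cmult[symmetric] wave_operator_def
    using hs[OF s] by (intro sphere_mean_add ci) auto
  ultimately show ?thesis
    using sphere_mean_angular[OF s] by simp
qed

end

section \<open>Distribution of linear functionals on the sphere\<close>

text \<open>Explicit derivatives of a function of one linear form. With a = (e, 1) or (e, -1) and e
  a unit vector these are the plane waves used below.\<close>

lemma C2_half_space_plane_wave:
  fixes k k' k'' :: "real \<Rightarrow> real" and a :: spacetime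
  assumes "\<And>x. (k has_real_derivative k' x) (at x)"
    and "\<And>x. (k' has_real_derivative k'' x) (at x)" and "continuous_on UNIV k''"
  shows "C2_half_space (\<lambda>z. k (a \<bullet> z)) (\<lambda>z. k' (a \<bullet> z) *\<^sub>R blinfun_inner_right a)
      (\<lambda>z. k'' (a \<bullet> z) *\<^sub>R (blinfun_scaleR_left (blinfun_inner_right a) o\<^sub>L blinfun_inner_right a))"
proof
  fix z :: spacetime
  have l: "((\<lambda>z. a \<bullet> z) has_derivative (\<lambda>z. a \<bullet> z)) (at z within half_space)"
    by (auto intro!: derivative_eq_intros)
  have "((\<lambda>z. k (a \<bullet> z)) has_derivative (\<lambda>v. k' (a \<bullet> z) * (a \<bullet> v))) (at z within half_space)"
    using DERIV_compose_FDERIV[OF assms(1) l] by (simp add: mult.commute)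
  then show "((\<lambda>z. k (a \<bullet> z)) has_derivative
      blinfun_apply (k' (a \<bullet> z) *\<^sub>R blinfun_inner_right a)) (at z within half_space)"
    by (rule has_derivative_eq_rhs) (simp add: blinfun.bilinear_simps fun_eq_iff)
  have "((\<lambda>z. k' (a \<bullet> z)) has_derivative (\<lambda>v. k'' (a \<bullet> z) * (a \<bullet> v))) (at z within half_space)"
    using DERIV_compose_FDERIV[OF assms(2) l] by (simp add: mult.commute)
  then have "((\<lambda>z. k' (a \<bullet> z) *\<^sub>R blinfun_inner_right a) has_derivative
      (\<lambda>v. (k'' (a \<bullet> z) * (a \<bullet> v)) *\<^sub>R blinfun_inner_right a)) (at z within half_space)"
    by (rule has_derivative_scaleR_left)
  then show "((\<lambda>z. k' (a \<bullet> z) *\<^sub>R blinfun_inner_right a) has_derivative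
      blinfun_apply (k'' (a \<bullet> z) *\<^sub>R (blinfun_scaleR_left (blinfun_inner_right a) o\<^sub>L
          blinfun_inner_right a)))
      (at z within half_space)"
    by (rule has_derivative_eq_rhs) (simp add: blinfun.bilinear_simps fun_eq_iff)
next
  show "continuous_on half_space
      (\<lambda>z. k'' (a \<bullet> z) *\<^sub>R (blinfun_scaleR_left (blinfun_inner_right a) o\<^sub>L blinfun_inner_right a))"
    by (intro continuous_intros continuous_on_compose2[OF assms(3)]) auto
qed

text \<open>By \<open>cone_mean_deriv\<close> the cone mean does not depend on s: this is
  Kirchhoff's formula for exact solutions.\<close>

lemma (in C2_half_space) cone_mean_const_if_wave_0:
  assumes "\<And>z. wave_operator z = 0" "t \<ge> 0"
  shows "cone_mean x t t = u (x, t)"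
proof -
  have "\<exists>c. \<forall>s\<in>{0..t}. cone_mean x t s = c"
    using cone_mean_deriv[of _ t x] by (intro has_field_derivative_zero_constant) (auto simp: assms(1))
  then show ?thesis using cone_mean_0[OF assms(2), of x] assms(2) by force
qed

text \<open>Archimedes: \<open>x \<bullet> \<xi>\<close> is uniformly distributed on \<open>[- |x|, |x|]\<close>. Applying Kirchhoff's formula to
  the plane waves \<open>k (e \<bullet> y + t)\<close> and \<open>k (e \<bullet> y - t)\<close> replaces the rotation of coordinates.\<close>
lemma sphere_mean_inner:
  fixes k k' k'' :: "real \<Rightarrow> real"
  assumes k: "\<And>x. (k has_real_derivative k' x) (at x)"
    and k': "\<And>x. (k' has_real_derivative k'' x) (at x)" and k'': "continuous_on UNIV k''"
  shows "2 * norm x * sphere_mean (\<lambda>\<xi>. k' (x \<bullet> \<xi>)) = k (norm x) - k (- norm x)"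
proof (cases "x = 0")
  case False
  define r e where "r = norm x" and "e = x /\<^sub>R r"
  have r: "r > 0" and e: "norm e = 1" and x: "r *\<^sub>R e = x" using False by (auto simp: r_def e_def)
  have ck: "continuous_on UNIV k" "continuous_on UNIV k'"
    using k k' DERIV_continuous_on by blast+
  \<comment> \<open>The wave with velocity sign c is evaluated at the origin at time r. Subtracting
    the identities for c = 1 and c = -1 eliminates the first mean.\<close>
  have *: "k (c * r) = sphere_mean (\<lambda>\<xi>. k (x \<bullet> \<xi>) + k' (x \<bullet> \<xi>) * (x \<bullet> \<xi>))
      + c * r * sphere_mean (\<lambda>\<xi>. k' (x \<bullet> \<xi>))"
    if c: "c = 1 \<or> c = - 1" for c
  proof -
    interpret C2_half_space "\<lambda>z. k ((e, c) \<bullet> z)" "\<lambda>z. k' ((e, c) \<bullet> z) *\<^sub>R blinfun_inner_right (e, c)"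
      "\<lambda>z. k'' ((e, c) \<bullet> z) *\<^sub>R (blinfun_scaleR_left (blinfun_inner_right (e, c)) o\<^sub>L
          blinfun_inner_right (e, c))"
      by (rule C2_half_space_plane_wave[OF assms])
    have "(\<Sum>i\<in>UNIV. (e $ i)\<^sup>2) = 1"
      using e by (simp add: norm_eq_1 inner_vec_def power2_eq_square)
    then have "wave_operator z = 0" for z
      using c by (auto simp: wave_operator_def blinfun.bilinear_simps inner_axis power2_eq_square mult.assoc
          simp flip: sum_distrib_left)
    from cone_mean_const_if_wave_0[OF this, of r 0]
    have "k (c * r) = sphere_mean (\<lambda>\<xi>. k (e \<bullet> (r *\<^sub>R \<xi>)) + r * (k' (e \<bullet> (r *\<^sub>R \<xi>)) * (e \<bullet> \<xi> + c)))"
      using r by (simp add: cone_mean_def blinfun.bilinear_simps)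
    also have "\<dots> = sphere_mean (\<lambda>\<xi>. (k (x \<bullet> \<xi>) + k' (x \<bullet> \<xi>) * (x \<bullet> \<xi>)) + c * r * k' (x \<bullet> \<xi>))"
      by (intro sphere_mean_cong) (simp add: algebra_simps flip: x)
    also have "\<dots> = sphere_mean (\<lambda>\<xi>. k (x \<bullet> \<xi>) + k' (x \<bullet> \<xi>) * (x \<bullet> \<xi>))
        + c * r * sphere_mean (\<lambda>\<xi>. k' (x \<bullet> \<xi>))"
      unfolding sphere_mean_cmult[symmetric]
      by (intro sphere_mean_add continuous_intros continuous_on_compose2[OF ck(1)]
          continuous_on_compose2[OF ck(2)]) auto
    finally show ?thesis .
  qed
  from *[of 1] *[of "-1"] show ?thesis by (simp add: r_def)
qed auto

lemma sphere_mean_inner_0: "sphere_mean (\<lambda>\<xi>. x \<bullet> \<xi>) = 0"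
proof (cases "x = 0")
  case False
  have "2 * norm x * sphere_mean (\<lambda>\<xi>. x \<bullet> \<xi>) = (norm x)\<^sup>2 / 2 - (- norm x)\<^sup>2 / 2"
    by (rule sphere_mean_inner[of "\<lambda>x. x\<^sup>2 / 2" "\<lambda>x. x" "\<lambda>_. 1"]) (auto intro!: derivative_eq_intros)
  then show ?thesis using False by simp
qed simp

section \<open>Truncated powers and zones of the sphere\<close>

lemma max_0_power_deriv:
  fixes x :: real
  assumes "n > 0"
  shows "((\<lambda>x. max 0 x ^ Suc n) has_real_derivative Suc n * max 0 x ^ n) (at x)"
proof -
  consider "x > 0" | "x < 0" | "x = 0" by linarith
  then show ?thesis
  proof cases
    case 1
    have "((\<lambda>x. x ^ Suc n) has_real_derivative Suc n * x ^ n) (at x)"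
      using DERIV_pow[of "Suc n" x] by simp
    then have "((\<lambda>x. max 0 x ^ Suc n) has_real_derivative Suc n * x ^ n) (at x)"
      by (rule has_field_derivative_transform_within_open[where S = "{0<..}"]) (use 1 in auto)
    then show ?thesis using 1 by simp
  next
    case 2
    have "((\<lambda>x::real. 0::real) has_real_derivative 0) (at x)" by simp
    then have "((\<lambda>x. max 0 x ^ Suc n) has_real_derivative 0) (at x)"
      by (rule has_field_derivative_transform_within_open[where S = "{..<0}"]) (use 2 in auto)
    then show ?thesis using 2 assms by (simp add: zero_power)
  next
    case 3
    \<comment> \<open>At the knot the difference quotient is \<open>h ^ n\<close> on the right and 0
      on the left, so \<open>\<bar>h\<bar> ^ n\<close> dominates it.\<close>
    have "((\<lambda>h::real. \<bar>h\<bar> ^ n) \<longlongrightarrow> \<bar>0\<bar> ^ n) (at 0)"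
      by (intro tendsto_intros)
    then have "((\<lambda>h::real. \<bar>h\<bar> ^ n) \<longlongrightarrow> 0) (at 0)" using assms by (simp only: abs_zero zero_power)
    then have "((\<lambda>h::real. max 0 h ^ Suc n / h) \<longlongrightarrow> 0) (at 0)"
      by (rule Lim_null_comparison[rotated]) (auto simp: eventually_at_filter max_def)
    then show ?thesis using 3 assms by (simp add: has_field_derivative_iff zero_power)
  qed
qed

lemma max_0_diff_power_deriv:
  fixes c y :: real
  assumes "n > 0"
  shows "((\<lambda>y. max 0 (y - c) ^ Suc n) has_real_derivative Suc n * max 0 (y - c) ^ n) (at y)"
proof -
  have "((\<lambda>y. y - c) has_real_derivative 1) (at y)" by (auto intro!: derivative_eq_intros)
  from DERIV_chain2[where g = "\<lambda>y. y - c", OF max_0_power_deriv[OF assms] this]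
  show ?thesis by simp
qed

text \<open>The indicator function of \<open>[a, b]\<close> is minorised by a quadratic B-spline, which has an
  antiderivative of class \<open>C\<^sup>2\<close>.\<close>
lemma sphere_mean_zone:
  assumes f: "continuous_on (sphere 0 1) f" "\<And>\<xi>. norm \<xi> = 1 \<Longrightarrow> f \<xi> \<ge> 0"
    and ab: "- norm x \<le> a" "a < b" "b \<le> norm x"
    and m: "\<And>\<xi>. norm \<xi> = 1 \<Longrightarrow> a \<le> x \<bullet> \<xi> \<Longrightarrow> x \<bullet> \<xi> \<le> b \<Longrightarrow> m \<le> f \<xi>" "m \<ge> 0"
  shows "m * (b - a) / (36 * norm x) \<le> sphere_mean f"
proof -
  \<comment> \<open>The knots of the spline \<open>B\<close> cut the interval into thirds.
    \<open>B\<close> has integral \<open>2 * h ^ 3\<close> and is at most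
    \<open>12 * h\<^sup>2\<close>, whence the constant 36 = 12 * 3.\<close>
  define h where "h = (b - a) / 3"
  have h: "h > 0" and b: "b = a + 3 * h" using ab by (auto simp: h_def field_simps)
  define P where "P y = max 0 y" for y :: real
  define B where "B y = P (y - a) ^ 2 - 3 * P (y - (a + h)) ^ 2 + 3 * P (y - (a
      + 2 * h)) ^ 2 - P (y - b) ^ 2" for y
  define k where "k y = (P (y - a) ^ 3 - 3 * P (y - (a + h)) ^ 3 + 3 * P (y - (a
      + 2 * h)) ^ 3 - P (y - b) ^ 3) / 3" for y
  define B' where "B' y = 2 * P (y - a) - 6 * P (y - (a + h)) + 6 * P (y - (a
      + 2 * h)) - 2 * P (y - b)" for y
  have P3: "((\<lambda>y. P (y - c) ^ 3) has_real_derivative 3 * P (y - c) ^ 2) (at y)" for y c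
    using max_0_diff_power_deriv[of 2 c y] by (simp add: P_def eval_nat_numeral)
  have P2: "((\<lambda>y. P (y - c) ^ 2) has_real_derivative 2 * P (y - c)) (at y)" for y c
    using max_0_diff_power_deriv[of 1 c y] by (simp add: P_def eval_nat_numeral)
  have "2 * norm x * sphere_mean (\<lambda>\<xi>. B (x \<bullet> \<xi>)) = k (norm x) - k (- norm x)"
  proof (rule sphere_mean_inner)
    show "(k has_real_derivative B y) (at y)" for y
      unfolding k_def [abs_def] B_def
      by (rule DERIV_cong[OF DERIV_cdivide[OF DERIV_diff[OF DERIV_add[OF DERIV_diff[OF P3
              DERIV_cmult[OF P3]] DERIV_cmult[OF P3]] P3]]]) simp
    show "(B has_real_derivative B' y) (at y)" for y
      unfolding B'_def B_def [abs_def]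
      by (rule DERIV_cong[OF DERIV_diff[OF DERIV_add[OF DERIV_diff[OF P2
              DERIV_cmult[OF P2]] DERIV_cmult[OF P2]] P2]]) simp
    show "continuous_on UNIV B'"
      unfolding B'_def [abs_def] P_def by (intro continuous_intros)
  qed
  \<comment> \<open>At the lower end all truncated powers are still 0. At the upper end none is
    truncated, and the third difference of the cube with step h is \<open>6 * h ^ 3\<close>.\<close>
  also have "k (- norm x) = 0" using ab h b by (simp add: k_def P_def)
  also have "k (norm x) = 2 * h ^ 3"
  proof -
    have "P (norm x - c) = norm x - c" if "c \<le> b" for c using that ab by (simp add: P_def)
    then show ?thesis using h b by (simp add: k_def) (simp add: power3_eq_cube algebra_simps)
  qed
  finally have S: "2 * norm x * sphere_mean (\<lambda>\<xi>. B (x \<bullet> \<xi>)) = 2 * h ^ 3" by simp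
  \<comment> \<open>To the right of the last knot \<open>B\<close> is the third difference of a
    quadratic polynomial.\<close>
  have B0: "B y = 0" if "y \<le> a \<or> b \<le> y" for y
  proof (cases "y \<le> a")
    case True
    then show ?thesis using h b by (simp add: B_def P_def)
  next
    case False
    then have "P (y - c) = y - c" if "c \<le> b" for c using that \<open>y \<le> a \<or> b \<le> y\<close> by (simp add: P_def)
    then show ?thesis using h b by (simp add: B_def) (simp add: power2_eq_square algebra_simps)
  qed
  have B1: "B y \<le> 12 * h\<^sup>2" if "a \<le> y" "y \<le> b" for y
  proof -
    have "P (y - a) ^ 2 \<le> (3 * h) ^ 2"
      by (rule power_mono) (use that h b in \<open>auto simp: P_def\<close>)
    moreover have "P (y - (a + 2 * h)) ^ 2 \<le> h ^ 2"
      by (rule power_mono) (use that h b in \<open>auto simp: P_def\<close>)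
    moreover have "P (y - (a + h)) ^ 2 \<ge> 0" "P (y - b) ^ 2 \<ge> 0" by simp_all
    moreover have "(3 * h)\<^sup>2 = 9 * h\<^sup>2" by (simp add: power_mult_distrib)
    ultimately show ?thesis unfolding B_def by linarith
  qed
  have "m / (12 * h\<^sup>2) * sphere_mean (\<lambda>\<xi>. B (x \<bullet> \<xi>)) \<le> sphere_mean f"
    unfolding sphere_mean_cmult[symmetric]
  proof (rule sphere_mean_mono)
    show "continuous_on (sphere 0 1) (\<lambda>\<xi>. m / (12 * h\<^sup>2) * B (x \<bullet> \<xi>))"
      unfolding B_def P_def by (intro continuous_intros)
  next
    fix \<xi> :: "real^3" assume \<xi>: "norm \<xi> = 1"
    show "m / (12 * h\<^sup>2) * B (x \<bullet> \<xi>) \<le> f \<xi>"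
    proof (cases "a \<le> x \<bullet> \<xi> \<and> x \<bullet> \<xi> \<le> b")
      case True
      have "m / (12 * h\<^sup>2) * B (x \<bullet> \<xi>) \<le> m / (12 * h\<^sup>2) * (12 * h\<^sup>2)"
        using True m(2) B1 by (intro mult_left_mono) auto
      then show ?thesis using m(1)[OF \<xi>] True h by simp
    qed (use B0 f(2)[OF \<xi>] in auto)
  qed (use f in auto)
  moreover have x: "norm x > 0" using ab by linarith
  then have "sphere_mean (\<lambda>\<xi>. B (x \<bullet> \<xi>)) = h ^ 3 / norm x"
    using S by (simp add: field_simps)
  ultimately show ?thesis
    using h x by (simp add: b power2_eq_square power3_eq_cube mult.commute)
qed

section \<open>Lower bounds for solutions\<close>

text \<open>Young's inequality with the conjugate exponents N and N / (N - 1), rearranged; in this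
  way x = 0 is included.\<close>

lemma powr_above_tangent:
  fixes x y N :: real
  assumes "x \<ge> 0" "y > 0" "N \<ge> 1"
  shows "y powr N + N * y powr (N - 1) * (x - y) \<le> x powr N"
proof -
  have y: "y * y powr (N - 1) = y powr N" using assms powr_mult_base[of y "N - 1"] by simp
  show ?thesis
  proof (cases "N = 1")
    case False
    then have N: "N > 1" using assms by simp
    have "x * y powr (N - 1) \<le> x powr N / N + (y powr (N - 1)) powr (N / (N - 1)) / (N / (N - 1))"
      using N assms by (intro Youngs_inequality) (auto simp: field_simps)
    also have "\<dots> = x powr N / N + y powr N * (N - 1) / N" using N by (simp add: powr_powr)
    finally have "N * (x * y powr (N - 1)) \<le> x powr N + y powr N * (N - 1)"
      using N by (simp add: field_simps)
    then show ?thesis using y by (simp add: algebra_simps)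
  qed (use assms in simp)
qed

text \<open>The law of cosines. At fixed s the squared distance is affine in \<xi>, so bounds on the
  distance to \<open>y\<close> describe zones of the sphere.\<close>

lemma norm_shift_sphere:
  fixes x y \<xi> :: "real^3"
  assumes "norm \<xi> = 1"
  shows "(norm (x + s *\<^sub>R \<xi> - y))\<^sup>2 = (norm (x - y))\<^sup>2 + s\<^sup>2 + 2 * s * ((x - y) \<bullet> \<xi>)"
proof -
  have "(norm (w + s *\<^sub>R \<xi>))\<^sup>2 = (norm w)\<^sup>2 + s\<^sup>2 + 2 * s * (w \<bullet> \<xi>)" for w
    using assms by (simp add: power2_norm_eq_inner inner_add_left inner_add_right inner_commute
        norm_eq_1) (simp add: power2_eq_square)
  moreover have "x + s *\<^sub>R \<xi> - y = (x - y) + s *\<^sub>R \<xi>" by simp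
  ultimately show ?thesis by metis
qed

locale nonlinear_wave = C2_half_space +
  fixes A p :: real and x0 :: "real^3" and t0 :: real
  assumes A: "A > 0" and p: "p > 1"
    and wave: "t > 0 \<Longrightarrow> A * \<bar>u (x, t)\<bar> powr p \<le> wave_operator (x, t)"
    and free: "(x, t) \<in> forward_cone x0 t0 \<Longrightarrow> 0 \<le> free_solution u (x, t)"
begin

lemma continuous_powr_u:
  assumes "s \<le> t"
  shows "continuous_on (sphere 0 1) (\<lambda>\<xi>. \<bar>u (x + s *\<^sub>R \<xi>, t - s)\<bar> powr p)"
  using assms p by (intro continuous_on_powr' continuous_intros continuous_on_half_space) (auto
      simp: half_space_def)

text \<open>The cone mean runs from \<open>u (x, t)\<close> at s = 0 to the nonnegative free
  solution at s = t. It decreases throughout, and on \<open>{a..b}\<close> so fast that even its sum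
  with \<open>P\<close> decreases. An antiderivative \<open>P\<close> takes the place of an integral
  of \<open>g\<close>.\<close>

lemma lower_bound:
  assumes xt: "(x, t) \<in> forward_cone x0 t0" and ab: "0 \<le> a" "a \<le> b" "b \<le> t"
    and P: "continuous_on {a..b} P" "\<And>s. a < s \<Longrightarrow> s < b \<Longrightarrow> (P has_real_derivative g s) (at s)"
    and g: "\<And>s. a < s \<Longrightarrow> s < b \<Longrightarrow> g s \<le> A * s * sphere_mean (\<lambda>\<xi>. \<bar>u (x + s *\<^sub>R \<xi>, t - s)\<bar> powr p)"
  shows "P b - P a \<le> u (x, t)"
proof -
  let ?m = "\<lambda>s. A * s * sphere_mean (\<lambda>\<xi>. \<bar>u (x + s *\<^sub>R \<xi>, t - s)\<bar> powr p)"
  have cont: "continuous_on {0..t} (cone_mean x t)"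
    using cone_mean_deriv by (rule DERIV_continuous_on)
  have *: "cone_mean x t d + F d \<le> cone_mean x t c + F c"
    if cd: "0 \<le> c" "c \<le> d" "d \<le> t" and F: "continuous_on {c..d} F"
      "\<And>s. c < s \<Longrightarrow> s < d \<Longrightarrow> \<exists>g. (F has_real_derivative g) (at s) \<and> g \<le> ?m s" for c d F
  proof (rule DERIV_nonpos_imp_decreasing_open[OF cd(2)])
    show "continuous_on {c..d} (\<lambda>s. cone_mean x t s + F s)"
      using cont cd F(1) by (auto intro!: continuous_on_add intro: continuous_on_subset)
    fix s assume s: "c < s" "s < d"
    then obtain g where g: "(F has_real_derivative g) (at s)" "g \<le> ?m s" using F(2) by blast
    let ?W = "sphere_mean (\<lambda>\<xi>. wave_operator (x + s *\<^sub>R \<xi>, t - s))"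
    have "(cone_mean x t has_real_derivative - s * ?W) (at s)"
      using cone_mean_deriv[of s t x] s cd by (simp add: at_within_Icc_at)
    then have "((\<lambda>s. cone_mean x t s + F s) has_real_derivative - s * ?W + g) (at s)"
      using g(1) by (rule DERIV_add)
    moreover have "A * sphere_mean (\<lambda>\<xi>. \<bar>u (x + s *\<^sub>R \<xi>, t - s)\<bar> powr p) \<le> ?W"
      unfolding sphere_mean_cmult[symmetric]
    proof (rule sphere_mean_mono)
      show "continuous_on (sphere 0 1) (\<lambda>\<xi>. A * \<bar>u (x + s *\<^sub>R \<xi>, t - s)\<bar> powr p)"
        using s cd by (intro continuous_on_mult_left continuous_powr_u) auto
      show "continuous_on (sphere 0 1) (\<lambda>\<xi>. wave_operator (x + s *\<^sub>R \<xi>, t - s))"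
        unfolding wave_operator_def using s cd
        by (intro continuous_intros continuous_on_half_space) (auto simp: half_space_def)
    qed (use s cd wave in auto)
    then have "s * (A * sphere_mean (\<lambda>\<xi>. \<bar>u (x + s *\<^sub>R \<xi>, t - s)\<bar> powr p)) \<le> s * ?W"
      using s cd by (intro mult_left_mono) auto
    then have "- s * ?W + g \<le> 0" using g(2) by (simp add: mult_ac)
    ultimately show "\<exists>y. ((\<lambda>s. cone_mean x t s + F s) has_real_derivative y) (at s) \<and> y \<le> 0"
      by blast
  qed
  have m: "0 \<le> ?m s" if "0 \<le> s" "s \<le> t" for s
    using sphere_mean_mono[OF _ continuous_powr_u[OF that(2)], of "\<lambda>_. 0" x] that A by simp
  have t: "t \<ge> 0" using ab by simp
  have "0 \<le> cone_mean x t t"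
    using free[OF xt] cone_mean_initial[OF t] by simp
  also have "cone_mean x t t \<le> cone_mean x t b"
    using *[of b t "\<lambda>_. 0"] ab m by (force intro!: exI[of _ 0])
  also have "\<dots> \<le> cone_mean x t a + P a - P b"
    using *[of a b P] ab P g by force
  also have "cone_mean x t a \<le> u (x, t)"
    using *[of 0 a "\<lambda>_. 0"] ab m cone_mean_0[OF t] by (force intro!: exI[of _ 0])
  finally show ?thesis by simp
qed

lemma lower_bound_const:
  assumes "(x, t) \<in> forward_cone x0 t0" "0 \<le> a" "a \<le> b" "b \<le> t"
    and "\<And>s. a < s \<Longrightarrow> s < b \<Longrightarrow> c \<le> A * s * sphere_mean (\<lambda>\<xi>. \<bar>u (x + s *\<^sub>R \<xi>, t - s)\<bar> powr p)"
  shows "c * (b - a) \<le> u (x, t)"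
  using lower_bound[OF assms(1-4), of "\<lambda>s. c * s" "\<lambda>_. c"] assms(5)
  by (auto intro!: derivative_eq_intros continuous_intros simp: right_diff_distrib)

text \<open>For the empty interval a = b = 0 there is nothing to verify, and the bound is 0.\<close>

lemma nonneg: "(x, t) \<in> forward_cone x0 t0 \<Longrightarrow> 0 \<le> u (x, t)"
  using lower_bound_const[of x t 0 0 0] by (simp add: forward_cone_def)

text \<open>For \<open>s\<close> within \<open>\<delta> / 2\<close> of the distance r from
  \<open>x\<close> to \<open>x1\<close>, the sphere of radius s about \<open>x\<close> cuts a cap
  out of the ball of radius \<delta> about \<open>x1\<close>, at a time when \<open>u\<close> is
  large there. The cap fills a share of the sphere of order
  \<open>\<delta>\<^sup>2 / (r * s)\<close>, and the s-interval has length \<delta>.\<close>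

lemma shell_bound:
  assumes \<delta>: "\<delta> > 0" and \<epsilon>: "\<epsilon> > 0" and t1: "t1 \<ge> \<delta>"
    and big: "\<And>y \<tau>. norm (y - x1) \<le> \<delta> \<Longrightarrow> \<bar>\<tau> - t1\<bar> \<le> \<delta> \<Longrightarrow> \<epsilon> \<le> \<bar>u (y, \<tau>)\<bar>"
    and xt: "(x, t) \<in> forward_cone x0 t0" and r: "norm (x - x1) \<ge> \<delta>"
    and shell: "\<bar>t - t1 - norm (x - x1)\<bar> \<le> \<delta> / 4"
  shows "A * \<epsilon> powr p * \<delta> ^ 3 / 96 / norm (x - x1) \<le> u (x, t)"
proof -
  define r where "r = norm (x - x1)"
  have r: "r \<ge> \<delta>" "\<bar>t - t1 - r\<bar> \<le> \<delta> / 4" using r shell by (auto simp: r_def)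
  have "A * (\<epsilon> powr p * \<delta>\<^sup>2 / (96 * r)) * ((r + \<delta> / 2) - (r - \<delta> / 2)) \<le> u (x, t)"
  proof (rule lower_bound_const[OF xt])
    fix s assume s: "r - \<delta> / 2 < s" "s < r + \<delta> / 2"
    then have s0: "s > 0" using r \<delta> by linarith
    have rs: "(r - s)\<^sup>2 \<le> (\<delta> / 2)\<^sup>2" using s unfolding abs_le_square_iff[symmetric] by linarith
    \<comment> \<open>By the law of cosines the cap is the zone where the inner product lies between
      -r and b. As \<open>(r - s)\<^sup>2\<close> takes at most a quarter of
      \<open>\<delta>\<^sup>2\<close>, the width of the zone is at least
      \<open>3 / 8 * \<delta>\<^sup>2 / s\<close>.\<close>
    define b where "b = (\<delta>\<^sup>2 - r\<^sup>2 - s\<^sup>2) / (2 * s)"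
    have bs: "2 * s * b = \<delta>\<^sup>2 - r\<^sup>2 - s\<^sup>2" using s0 by (simp add: b_def)
    have len: "3 / 8 * \<delta>\<^sup>2 / s \<le> b + r"
    proof -
      have "2 * s * (b + r) = \<delta>\<^sup>2 - (r - s)\<^sup>2" using bs by (simp add: algebra_simps power2_eq_square)
      then have "3 / 4 * \<delta>\<^sup>2 \<le> 2 * s * (b + r)" using rs by (simp add: power_divide)
      then show ?thesis using s0 by (simp add: field_simps)
    qed
    have "\<epsilon> powr p * (b - - r) / (36 * norm (x - x1)) \<le> sphere_mean (\<lambda>\<xi>. \<bar>u (x + s *\<^sub>R \<xi>, t - s)\<bar> powr p)"
    proof (rule sphere_mean_zone[OF continuous_powr_u])
      show "s \<le> t" using r s t1 \<delta> by linarith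
      show "- norm (x - x1) \<le> - r" by (simp add: r_def)
      have "3 / 8 * \<delta>\<^sup>2 / s > 0" using \<delta> s0 by simp
      then show "- r < b" using len by linarith
      have "\<delta>\<^sup>2 \<le> (r + s)\<^sup>2" using r s0 \<delta> by (intro power_mono) auto
      then have "2 * s * b \<le> 2 * s * r" unfolding bs by (simp add: algebra_simps power2_eq_square)
      then show "b \<le> norm (x - x1)" using s0 by (simp add: r_def)
    next
      fix \<xi> :: "real^3" assume \<xi>: "norm \<xi> = 1" and b: "(x - x1) \<bullet> \<xi> \<le> b"
      have "2 * s * ((x - x1) \<bullet> \<xi>) \<le> 2 * s * b" using b s0 by simp
      then have "(norm (x + s *\<^sub>R \<xi> - x1))\<^sup>2 \<le> \<delta>\<^sup>2"
        unfolding norm_shift_sphere[OF \<xi>] bs by (simp add: r_def)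
      then have "norm (x + s *\<^sub>R \<xi> - x1) \<le> \<delta>" using \<delta> by (simp add: power2_le_iff_abs_le)
      moreover have "\<bar>t - s - t1\<bar> \<le> \<delta>" using r s by linarith
      ultimately show "\<epsilon> powr p \<le> \<bar>u (x + s *\<^sub>R \<xi>, t - s)\<bar> powr p"
        using p \<epsilon> by (intro powr_mono2 big) auto
    qed auto
    moreover have "\<epsilon> powr p * (3 / 8 * \<delta>\<^sup>2 / s) / (36 * r) \<le> \<epsilon> powr p * (b - - r) / (36 * norm (x - x1))"
      unfolding r_def[symmetric] using len r \<delta> by (intro divide_right_mono mult_left_mono) auto
    ultimately have "A * s * (\<epsilon> powr p * (3 / 8 * \<delta>\<^sup>2 / s) / (36 * r))
        \<le> A * s * sphere_mean (\<lambda>\<xi>. \<bar>u (x + s *\<^sub>R \<xi>, t - s)\<bar> powr p)"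
      using A s0 by (intro mult_left_mono) auto
    then show "A * (\<epsilon> powr p * \<delta>\<^sup>2 / (96 * r)) \<le> A * s * sphere_mean (\<lambda>\<xi>. \<bar>u (x + s *\<^sub>R \<xi>, t - s)\<bar> powr p)"
      using s0 by simp
  qed (use r \<delta> t1 in linarith)+
  then show ?thesis by (simp add: r_def power2_eq_square power3_eq_cube)
qed

text \<open>The sphere of radius s about \<open>x\<close> meets the shell, where \<open>u\<close> is
  at least c divided by the distance to \<open>x0\<close>. Integration over an s-interval of length
  comparable to the distance from \<open>x\<close> to \<open>x0\<close> cancels that distance in the
  denominator of the zone estimate.\<close>

lemma cone_bound:
  assumes \<eta>: "\<eta> > 0" and c: "c > 0" and T: "T \<ge> 0" "t0 \<le> T"
    and shell: "\<And>y \<tau>. norm (y - x0) \<ge> 8 * \<eta> \<Longrightarrow> \<bar>\<tau> - T - norm (y - x0)\<bar> \<le> 2 * \<eta> \<Longrightarrow> c / norm (y - x0)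
        \<le> u (y, \<tau>)"
    and xt: "norm (x - x0) + 32 * \<eta> \<le> t - T"
  shows "A * c powr p * \<eta> / 144 * (t - T) powr (1 - p) \<le> u (x, t)"
proof -
  define r t' where "r = norm (x - x0)" and "t' = t - T"
  have r: "r \<ge> 0" "r + 32 * \<eta> \<le> t'" using xt by (auto simp: r_def t'_def)
  have t': "t' > 0" "t' \<le> t" using r \<eta> T by (auto simp: t'_def)
  have cone: "(x, t) \<in> forward_cone x0 t0" using xt \<eta> T t' r by (auto simp: forward_cone_def)
  have pw: "t' * (c / t') powr p = c powr p * t' powr (1 - p)" if "t' > 0" for t'
    using that by (simp add: powr_divide powr_diff)
  show ?thesis
  proof (cases "r \<ge> \<eta>")
    case True
    \<comment> \<open>For these s the sphere crosses the whole annulus of points at distance between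
      \<open>\<tau> - \<eta>\<close> and \<tau> from \<open>x0\<close>, where \<tau> = t' - s. The
      margin \<open>32 * \<eta>\<close> makes \<tau> at least \<open>16 * \<eta>\<close>, so the
      annulus lies in the shell.\<close>
    have "A * (c powr p * t' powr (1 - p) * \<eta> / (72 * r)) * ((t' + r - \<eta>) / 2 - (t' - r) / 2) \<le> u (x, t)"
    proof (rule lower_bound_const[OF cone])
      fix s assume "(t' - r) / 2 < s" "s < (t' + r - \<eta>) / 2"
      then have s: "t' - r < 2 * s" "2 * s < t' + r - \<eta>" by simp_all
      define \<tau> where "\<tau> = t' - s"
      have s0: "s > 0" using s r \<eta> by linarith
      have \<tau>: "\<tau> \<ge> 16 * \<eta>" "\<tau> < r + s" "\<tau> - \<eta> > \<bar>r - s\<bar>" "\<tau> \<le> t'" "\<tau> > 0"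
        using s s0 r \<eta> unfolding \<tau>_def by linarith+
      define a b where "a = ((\<tau> - \<eta>)\<^sup>2 - r\<^sup>2 - s\<^sup>2) / (2 * s)" and "b = (\<tau>\<^sup>2 - r\<^sup>2 - s\<^sup>2) / (2 * s)"
      have ab: "2 * s * a = (\<tau> - \<eta>)\<^sup>2 - r\<^sup>2 - s\<^sup>2" "2 * s * b = \<tau>\<^sup>2 - r\<^sup>2 - s\<^sup>2"
        using s0 by (auto simp: a_def b_def)
      have len: "\<tau> * \<eta> \<le> 2 * s * (b - a)"
      proof -
        have "2 * s * (b - a) = 2 * \<tau> * \<eta> - \<eta> * \<eta>"
          using ab by (simp add: algebra_simps power2_eq_square)
        moreover have "\<eta> * \<eta> \<le> \<tau> * \<eta>" using \<tau> \<eta> by (intro mult_right_mono) auto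
        ultimately show ?thesis by linarith
      qed
      have "(c / \<tau>) powr p * (b - a) / (36 * norm (x - x0)) \<le> sphere_mean (\<lambda>\<xi>. \<bar>u (x
          + s *\<^sub>R \<xi>, t - s)\<bar> powr p)"
      proof (rule sphere_mean_zone[OF continuous_powr_u])
        show "s \<le> t" using s r t' \<eta> by linarith
        have "0 < \<tau> * \<eta>" using \<tau> \<eta> by simp
        then have "0 < 2 * s * (b - a)" using len by linarith
        then show "a < b" using s0 by (simp add: zero_less_mult_iff)
        have "(r - s)\<^sup>2 \<le> (\<tau> - \<eta>)\<^sup>2" using \<tau> unfolding abs_le_square_iff[symmetric] by linarith
        moreover have "2 * s * (- r) = - (2 * r * s)" by simp
        ultimately have "2 * s * (- r) \<le> 2 * s * a" unfolding ab power2_diff by linarith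
        then show "- norm (x - x0) \<le> a"
          unfolding r_def[symmetric] using s0 by (metis mult_le_cancel_left_pos mult_pos_pos
              zero_less_numeral)
        have "\<tau>\<^sup>2 \<le> (r + s)\<^sup>2" using \<tau>(2,5) by (intro power_mono) auto
        moreover have "2 * s * r = 2 * r * s" by simp
        ultimately have "2 * s * b \<le> 2 * s * r" unfolding ab power2_sum by linarith
        then show "b \<le> norm (x - x0)"
          unfolding r_def[symmetric] using s0 by (metis mult_le_cancel_left_pos mult_pos_pos
              zero_less_numeral)
      next
        fix \<xi> :: "real^3" assume \<xi>: "norm \<xi> = 1" and w: "a \<le> (x - x0) \<bullet> \<xi>" "(x - x0) \<bullet> \<xi> \<le> b"
        let ?l = "norm (x + s *\<^sub>R \<xi> - x0)"
        have "2 * s * a \<le> 2 * s * ((x - x0) \<bullet> \<xi>)" "2 * s * ((x - x0) \<bullet> \<xi>) \<le> 2 * s * b"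
          using w s0 by (auto intro!: mult_left_mono)
        then have "(\<tau> - \<eta>)\<^sup>2 \<le> ?l\<^sup>2" "?l\<^sup>2 \<le> \<tau>\<^sup>2"
          using norm_shift_sphere[OF \<xi>, of x s x0, folded r_def] ab by linarith+
        then have l: "\<tau> - \<eta> \<le> ?l" "?l \<le> \<tau>" using \<tau>(5) by (auto intro: power2_le_imp_le)
        have "c / \<tau> \<le> c / ?l" using l \<tau>(1) \<eta> c by (intro divide_left_mono mult_pos_pos) auto
        also have "\<dots> \<le> u (x + s *\<^sub>R \<xi>, t - s)"
          using l \<tau>(1) \<eta> unfolding \<tau>_def t'_def
          by (intro shell; linarith)
        finally show "(c / \<tau>) powr p \<le> \<bar>u (x + s *\<^sub>R \<xi>, t - s)\<bar> powr p"
          using p c \<tau>(5) by (intro powr_mono2) auto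
      qed auto
      then have "A * s * ((c / \<tau>) powr p * (b - a) / (36 * r)) \<le> A * s * sphere_mean (\<lambda>\<xi>. \<bar>u (x
          + s *\<^sub>R \<xi>, t - s)\<bar> powr p)"
        using A s0 by (intro mult_left_mono) (auto simp: r_def)
      moreover have "A * s * ((c / \<tau>) powr p * (b - a) / (36 * r))
          = A * ((c / \<tau>) powr p * (2 * s * (b - a)) / (72 * r))"
        by simp
      moreover have "A * ((c / \<tau>) powr p * (\<tau> * \<eta>) / (72 * r))
          \<le> A * ((c / \<tau>) powr p * (2 * s * (b - a)) / (72 * r))"
        using A len True \<eta> by (intro mult_left_mono divide_right_mono) auto
      moreover have "c powr p * t' powr (1 - p) * \<eta> \<le> c powr p * \<tau> powr (1 - p) * \<eta>"
        using \<tau>(4,5) p \<eta> by (intro mult_left_mono mult_right_mono powr_mono2') auto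
      then have "A * (c powr p * t' powr (1 - p) * \<eta> / (72 * r))
          \<le> A * ((c / \<tau>) powr p * (\<tau> * \<eta>) / (72 * r))"
        using A r True \<eta> pw[OF \<tau>(5)] by (intro mult_left_mono divide_right_mono) (auto simp: mult_ac)
      ultimately show "A * (c powr p * t' powr (1 - p) * \<eta> / (72 * r))
          \<le> A * s * sphere_mean (\<lambda>\<xi>. \<bar>u (x + s *\<^sub>R \<xi>, t - s)\<bar> powr p)"
        by linarith
    qed (use r \<eta> t' True in auto)
    moreover have "A * c powr p * \<eta> / 144 * t' powr (1 - p)
        \<le> A * (c powr p * t' powr (1 - p) * \<eta> / (72 * r)) * ((t' + r - \<eta>) / 2 - (t' - r) / 2)"
    proof -
      have "A * c powr p * \<eta> / 144 * t' powr (1 - p)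
          = A * (c powr p * t' powr (1 - p) * \<eta> / (72 * r)) * (r / 2)"
        using True \<eta> by simp
      also have "\<dots> \<le> A * (c powr p * t' powr (1 - p) * \<eta> / (72 * r)) * ((t' + r - \<eta>) / 2 - (t' - r) / 2)"
        using True \<eta> A by (intro mult_left_mono) (auto simp: field_simps)
      finally show ?thesis .
    qed
    ultimately show ?thesis unfolding t'_def by linarith
  next
    case False
    \<comment> \<open>Near the axis the factor 1 / r is avoided: for s close to t' / 2 the whole
      sphere lies in the shell, and the mean of a constant suffices.\<close>
    have "A * (c powr p * t' powr (1 - p) / 4) * ((t' / 2 + \<eta> / 4) - (t' / 2 - \<eta> / 4)) \<le> u (x, t)"
    proof (rule lower_bound_const[OF cone])
      fix s assume "t' / 2 - \<eta> / 4 < s" "s < t' / 2 + \<eta> / 4"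
      then have s: "2 * t' - \<eta> < 4 * s" "4 * s < 2 * t' + \<eta>" by simp_all
      have st: "s \<le> t" "s \<ge> t' / 4" "s > 0" using s r t' \<eta> by linarith+
      have "sphere_mean (\<lambda>_. (c / t') powr p) \<le> sphere_mean (\<lambda>\<xi>. \<bar>u (x + s *\<^sub>R \<xi>, t - s)\<bar> powr p)"
      proof (rule sphere_mean_mono[OF _ continuous_powr_u[OF st(1)]])
        fix \<xi> :: "real^3" assume \<xi>: "norm \<xi> = 1"
        let ?l = "norm (x + s *\<^sub>R \<xi> - x0)"
        have "\<bar>?l - s\<bar> \<le> r"
          using norm_triangle_ineq3[of "x + s *\<^sub>R \<xi> - x0" "s *\<^sub>R \<xi>"] \<xi> st by (simp add: r_def)
        then have "?l \<le> s + \<eta>" "s - \<eta> \<le> ?l" using False by linarith+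
        then have l: "?l \<le> t'" "?l \<ge> 8 * \<eta>" "\<bar>t' - s - ?l\<bar> \<le> 2 * \<eta>"
          using s r t' \<eta> by linarith+
        then have "\<bar>t - s - T - ?l\<bar> \<le> 2 * \<eta>" by (simp add: t'_def algebra_simps)
        have "c / t' \<le> c / ?l" using l c \<eta> t' by (intro divide_left_mono mult_pos_pos) auto
        also have "\<dots> \<le> u (x + s *\<^sub>R \<xi>, t - s)" using l(2) \<open>\<bar>t - s - T - ?l\<bar> \<le> 2 * \<eta>\<close> by (rule shell)
        finally show "(c / t') powr p \<le> \<bar>u (x + s *\<^sub>R \<xi>, t - s)\<bar> powr p"
          using p c t' by (intro powr_mono2) auto
      qed auto
      then have "A * s * (c / t') powr p \<le> A * s * sphere_mean (\<lambda>\<xi>. \<bar>u (x + s *\<^sub>R \<xi>, t - s)\<bar> powr p)"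
        using A st by (intro mult_left_mono) auto
      moreover have "A * (t' / 4) * (c / t') powr p \<le> A * s * (c / t') powr p"
        using A st by (intro mult_left_mono mult_right_mono) auto
      ultimately show "A * (c powr p * t' powr (1 - p) / 4) \<le> A * s * sphere_mean (\<lambda>\<xi>. \<bar>u (x
          + s *\<^sub>R \<xi>, t - s)\<bar> powr p)"
        using pw[OF t'(1)] by (simp add: mult_ac)
    qed (use r \<eta> t' in auto)
    moreover have "A * c powr p * \<eta> / 144 * t' powr (1 - p)
        \<le> A * (c powr p * t' powr (1 - p) / 4) * ((t' / 2 + \<eta> / 4) - (t' / 2 - \<eta> / 4))"
    proof -
      have "0 \<le> A * c powr p * \<eta> * t' powr (1 - p)" using A \<eta> by simp
      then show ?thesis by (simp add: mult_ac)
    qed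
    ultimately show ?thesis unfolding t'_def by linarith
  qed
qed

text \<open>Jensen: at the points \<open>(x + s \<xi>, t - s)\<close> the quantity \<open>\<sigma>\<close> is affine in \<open>\<xi>\<close> with mean
  \<open>\<sigma> - 2 (t - T - b) s\<close>, and the given lower bound for \<open>|u|\<^sup>p\<close> is convex in \<open>\<sigma>\<close>.\<close>
lemma improved_bound:
  fixes a d C :: real
  assumes b: "b > 0" and T: "0 \<le> T" "t0 \<le> T" and a: "a \<ge> 1" and d: "d \<ge> 0" and C: "C > 0"
    and bound: "\<And>x t. norm (x - x0) \<le> t - T - b \<Longrightarrow>
      C * ((t - T - b)\<^sup>2 - (norm (x - x0))\<^sup>2) powr a * (t - T) powr (- d) \<le> u (x, t)"
    and xt: "norm (x - x0) \<le> t - T - b"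
  shows "A * C powr p / (4 * (p * a + 1) * (p * a + 2))
      * ((t - T - b)\<^sup>2 - (norm (x - x0))\<^sup>2) powr (p * a + 2) * (t - T) powr (- (p * d + 2)) \<le> u (x, t)"
proof -
  define r \<tau> \<theta> \<sigma> N where "r = norm (x - x0)" and "\<tau> = t - T - b" and "\<theta> = t - T"
    and "\<sigma> = (t - T - b)\<^sup>2 - (norm (x - x0))\<^sup>2" and "N = p * a"
  have N: "N \<ge> 1" using mult_mono[of 1 p 1 a] p a by (simp add: N_def)
  have r: "0 \<le> r" "r \<le> \<tau>" using xt by (auto simp: r_def \<tau>_def)
  have cone: "(x, t) \<in> forward_cone x0 t0" using xt T b order_trans[OF norm_ge_zero xt]
    by (auto simp: forward_cone_def)
  have \<sigma>: "\<sigma> = \<tau>\<^sup>2 - r\<^sup>2" by (simp add: \<sigma>_def \<tau>_def r_def)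
  have "\<sigma> \<ge> 0" using r by (simp add: \<sigma> power_mono)
  then consider "\<sigma> = 0" | "\<sigma> > 0" by linarith
  then show ?thesis
  proof cases
    case 1
    then show ?thesis using nonneg[OF cone] by (simp add: \<sigma>_def)
  next
    case 2
    have "\<tau> \<noteq> 0" using 2 by (auto simp: \<sigma>)
    then have \<tau>: "\<tau> > 0" using r by linarith
    have \<theta>: "\<theta> = \<tau> + b" "\<theta> > 0" using \<tau> b by (auto simp: \<theta>_def \<tau>_def)
    \<comment> \<open>At s = S the mean \<open>\<sigma> - 2 * \<tau> * s\<close> reaches 0, and the
      bound is integrated up to there.\<close>
    define S K where "S = \<sigma> / (2 * \<tau>)" and "K = A * C powr p * \<theta> powr (- (d * p))"
    have "\<sigma> \<le> \<tau> * \<tau>" by (simp add: \<sigma> power2_eq_square)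
    then have S: "0 < S" "S \<le> \<tau> / 2" using 2 \<tau> by (auto simp: S_def field_simps)
    have y0: "\<sigma> - 2 * \<tau> * s > 0" if "s < S" for s using that \<tau> by (simp add: S_def field_simps)
    \<comment> \<open>An antiderivative of \<open>K * s * y powr N\<close> with y = \<sigma> - 2
      \<tau> s, found by writing s as (\<sigma> - y) / (2 \<tau>).\<close>
    define P where "P s = K / (4 * \<tau>\<^sup>2) * ((\<sigma> - 2 * \<tau> * s) powr (N + 2) / (N
        + 2) - \<sigma> * (\<sigma> - 2 * \<tau> * s) powr (N + 1) / (N + 1))" for s
    have "P S - P 0 \<le> u (x, t)"
    proof (rule lower_bound[OF cone, where a = 0 and b = S and P = P and g
        = "\<lambda>s. K * s * (\<sigma> - 2 * \<tau> * s) powr N"])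
      show "0 \<le> S" "(0 :: real) \<le> 0" using S by simp_all
      show "S \<le> t" using S \<tau> b T by (simp add: \<tau>_def)
      have "\<sigma> - 2 * \<tau> * s \<ge> 0" if "s \<le> S" for s using that \<tau> by (simp add: S_def field_simps)
      then have c: "continuous_on {0..S} (\<lambda>s. (\<sigma> - 2 * \<tau> * s) powr M)" if "M > 0" for M
        using that by (intro continuous_on_powr' continuous_intros) auto
      show "continuous_on {0..S} P"
        unfolding P_def [abs_def] using N by (intro c continuous_intros) auto
    next
      fix s assume s: "0 < s" "s < S"
      let ?y = "\<sigma> - 2 * \<tau> * s"
      have D: "((\<lambda>s. (\<sigma> - 2 * \<tau> * s) powr M) has_real_derivative M * ?y powr (M - 1) * (- 2 * \<tau>))
          (at s)" for M
      proof -
        have "((\<lambda>s. \<sigma> - 2 * \<tau> * s) has_real_derivative - 2 * \<tau>) (at s)"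
          by (auto intro!: derivative_eq_intros)
        from DERIV_chain2[where f = "\<lambda>z. z powr M", OF has_real_derivative_powr[OF y0[OF s(2)]] this]
        show ?thesis .
      qed
      have "(P has_real_derivative K / (4 * \<tau>\<^sup>2) * (((N + 2) * ?y powr ((N + 2) - 1) * (- 2 * \<tau>)) / (N + 2)
          - \<sigma> * ((N + 1) * ?y powr ((N + 1) - 1) * (- 2 * \<tau>)) / (N + 1))) (at s)"
        unfolding P_def [abs_def]
        by (intro DERIV_cmult DERIV_diff DERIV_cdivide D)
      moreover have "K / (4 * \<tau>\<^sup>2) * (((N + 2) * ?y powr ((N + 2) - 1) * (- 2 * \<tau>)) / (N + 2)
          - \<sigma> * ((N + 1) * ?y powr ((N + 1) - 1) * (- 2 * \<tau>)) / (N + 1)) = K * s * ?y powr N"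
      proof -
        have e: "?y powr ((N + 2) - 1) = ?y powr N * ?y" "(N + 1) - 1 = N"
          using powr_mult_base[of ?y N] y0[OF s(2)] by (simp_all add: add.commute mult.commute)
        have c: "(N + 2) * X * Z / (N + 2) = X * Z" "\<sigma> * ((N + 1) * X * Z) / (N + 1) = \<sigma> * (X * Z)" for X Z
          using N by simp_all
        have "K / (4 * \<tau>\<^sup>2) * (?y powr N * ?y * (- 2 * \<tau>) - \<sigma> * (?y powr N * (- 2 * \<tau>)))
            = K / (4 * \<tau>\<^sup>2) * (4 * \<tau>\<^sup>2 * (s * ?y powr N))"
          by (simp add: algebra_simps power2_eq_square)
        also have "\<dots> = K * s * ?y powr N" using \<tau> by simp
        finally show ?thesis unfolding e c by simp
      qed
      ultimately show "(P has_real_derivative K * s * ?y powr N) (at s)" by simp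
    next
      fix s assume s: "0 < s" "s < S"
      let ?y = "\<sigma> - 2 * \<tau> * s"
      let ?c = "C powr p * \<theta> powr (- (d * p))"
      have y: "?y > 0" using y0 s by simp
      have st: "s \<le> t" using s S \<tau> b T by (simp add: \<tau>_def)
      have "sphere_mean (\<lambda>\<xi>. ?c * ?y powr N + (- ?c * N * ?y powr (N - 1) * 2 * s) * ((x - x0) \<bullet> \<xi>))
          \<le> sphere_mean (\<lambda>\<xi>. \<bar>u (x + s *\<^sub>R \<xi>, t - s)\<bar> powr p)"
      proof (rule sphere_mean_mono[OF _ continuous_powr_u[OF st]])
        show "continuous_on (sphere 0 1) (\<lambda>\<xi>. ?c * ?y powr N + (- ?c * N * ?y powr (N - 1) * 2 * s)
            * ((x - x0) \<bullet> \<xi>))"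
          by (intro continuous_intros)
        fix \<xi> :: "real^3" assume \<xi>: "norm \<xi> = 1"
        define w where "w = ?y - 2 * s * ((x - x0) \<bullet> \<xi>)"
        have w: "w = (t - s - T - b)\<^sup>2 - (norm (x + s *\<^sub>R \<xi> - x0))\<^sup>2"
        proof -
          have "(t - s - T - b)\<^sup>2 = (\<tau> - s)\<^sup>2" by (simp add: \<tau>_def algebra_simps)
          then show ?thesis unfolding norm_shift_sphere[OF \<xi>] w_def \<sigma>
            by (simp add: r_def power2_eq_square algebra_simps)
        qed
        \<comment> \<open>Points with w < 0 lie outside the shifted cone, and 0 replaces the bound
          there. The tangent is then at most 0 because N is at least 1.\<close>
        have "?y powr N + N * ?y powr (N - 1) * (w - ?y) \<le> (if w \<ge> 0 then w powr N else 0)"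
        proof (cases "w \<ge> 0")
          case True
          then show ?thesis using powr_above_tangent[OF True y N] by simp
        next
          case False
          have "?y powr N + N * ?y powr (N - 1) * (w - ?y) = ?y powr (N - 1) * (?y + N * (w - ?y))"
            using y powr_mult_base[of ?y "N - 1"] by (simp add: algebra_simps)
          moreover have "1 * (?y - w) \<le> N * (?y - w)" using N False y by (intro mult_right_mono) auto
          then have "?y + N * (w - ?y) \<le> 0" using False by (simp add: algebra_simps)
          ultimately show ?thesis using False by (simp add: mult_nonneg_nonpos)
        qed
        then have "?c * (?y powr N + N * ?y powr (N - 1) * (w - ?y)) \<le> ?c * (if w \<ge> 0 then w powr N else 0)"
          by (intro mult_left_mono) auto
        also have "\<dots> \<le> \<bar>u (x + s *\<^sub>R \<xi>, t - s)\<bar> powr p"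
        proof (cases "w \<ge> 0")
          case True
          have pos: "t - s - T - b \<ge> 0" using s S \<tau> by (simp add: \<tau>_def)
          then have "norm (x + s *\<^sub>R \<xi> - x0) \<le> t - s - T - b"
            using True power2_le_imp_le unfolding w by (smt (verit))
          from bound[OF this] have "C * w powr a * (t - s - T) powr (- d) \<le> u (x + s *\<^sub>R \<xi>, t - s)"
            by (simp add: w)
          moreover have "\<theta> powr (- d) \<le> (t - s - T) powr (- d)"
            using pos b s d by (intro powr_mono2') (auto simp: \<theta>_def)
          then have "C * w powr a * \<theta> powr (- d) \<le> C * w powr a * (t - s - T) powr (- d)"
            using C by (intro mult_left_mono) auto
          ultimately have "C * w powr a * \<theta> powr (- d) \<le> \<bar>u (x + s *\<^sub>R \<xi>, t - s)\<bar>" by linarith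
          then have "(C * w powr a * \<theta> powr (- d)) powr p \<le> \<bar>u (x + s *\<^sub>R \<xi>, t - s)\<bar> powr p"
            using p C by (intro powr_mono2) auto
          then show ?thesis using True
            by (simp add: powr_mult powr_powr N_def mult_ac)
        qed simp
        finally show "?c * ?y powr N + (- ?c * N * ?y powr (N - 1) * 2 * s) * ((x - x0) \<bullet> \<xi>)
            \<le> \<bar>u (x + s *\<^sub>R \<xi>, t - s)\<bar> powr p"
          by (simp add: w_def algebra_simps)
      qed
      also have "sphere_mean (\<lambda>\<xi>. ?c * ?y powr N + (- ?c * N * ?y powr (N - 1) * 2 * s) * ((x - x0)
          \<bullet> \<xi>)) = ?c * ?y powr N"
        by (subst sphere_mean_add; (intro continuous_intros)?)
           (simp only: sphere_mean_cmult sphere_mean_inner_0 sphere_mean_const mult_zero_right add_0_right)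
      finally have "A * s * (?c * ?y powr N) \<le> A * s * sphere_mean (\<lambda>\<xi>. \<bar>u (x + s *\<^sub>R \<xi>, t - s)\<bar> powr p)"
        using A s by (intro mult_left_mono) auto
      then show "K * s * ?y powr N \<le> A * s * sphere_mean (\<lambda>\<xi>. \<bar>u (x + s *\<^sub>R \<xi>, t - s)\<bar> powr p)"
        by (simp add: K_def mult_ac)
    qed
    moreover have "P S = 0"
    proof -
      have "\<sigma> - 2 * \<tau> * S = 0" using \<tau> by (simp add: S_def)
      then show ?thesis by (simp add: P_def)
    qed
    moreover have "- P 0 = K * \<sigma> powr (N + 2) / (4 * (N + 1) * (N + 2)) / \<tau>\<^sup>2"
    proof -
      have "\<sigma> * \<sigma> powr (N + 1) = \<sigma> powr (N + 2)" using 2 powr_mult_base[of \<sigma> "N + 1"] by (simp add: add_ac)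
      then have "P 0 = K / (4 * \<tau>\<^sup>2) * (\<sigma> powr (N + 2) / (N + 2) - \<sigma> powr (N + 2) / (N + 1))"
        by (simp add: P_def)
      also have "\<dots> = K / (4 * \<tau>\<^sup>2) * (- (\<sigma> powr (N + 2) / ((N + 1) * (N + 2))))"
        using N by (simp add: field_simps)
      finally show ?thesis by simp
    qed
    \<comment> \<open>The loss from \<tau> to \<theta> keeps the bound a product of powers of
      \<sigma> and \<theta>, as the next iteration requires.\<close>
    moreover have "K * \<sigma> powr (N + 2) / (4 * (N + 1) * (N + 2)) / \<theta>\<^sup>2 \<le> K * \<sigma> powr (N + 2) / (4 * (N
        + 1) * (N + 2)) / \<tau>\<^sup>2"
    proof (rule divide_left_mono)
      show "\<tau>\<^sup>2 \<le> \<theta>\<^sup>2" using \<theta> \<tau> b by (intro power_mono) auto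
      show "0 \<le> K * \<sigma> powr (N + 2) / (4 * (N + 1) * (N + 2))" using A N by (simp add: K_def)
    qed (use \<tau> \<theta> in auto)
    moreover have "K * \<sigma> powr (N + 2) / (4 * (N + 1) * (N + 2)) / \<theta>\<^sup>2
        = A * C powr p / (4 * (N + 1) * (N + 2)) * \<sigma> powr (N + 2) * \<theta> powr (- (p * d + 2))"
    proof -
      have K: "K / \<theta>\<^sup>2 = A * C powr p * \<theta> powr (- (p * d + 2))"
    proof -
      have "\<theta> powr (- (p * d + 2)) = \<theta> powr (- (d * p)) * \<theta> powr (- 2)"
        by (simp add: powr_add[symmetric] mult.commute)
      also have "\<theta> powr (- 2) = 1 / \<theta>\<^sup>2" using \<theta>(2) by (simp add: powr_minus_divide powr_numeral)
      finally show ?thesis by (simp add: K_def)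
    qed
      have "K * Y / Z / \<theta>\<^sup>2 = K / \<theta>\<^sup>2 * Y / Z" for Y Z by simp
      then show ?thesis unfolding K by simp
    qed
    ultimately have "A * C powr p / (4 * (N + 1) * (N + 2)) * \<sigma> powr (N + 2) * \<theta> powr (- (p * d
        + 2)) \<le> u (x, t)"
      by linarith
    then show ?thesis unfolding \<sigma>_def \<theta>_def N_def .
  qed
qed

end

section \<open>Iteration of the lower bounds\<close>

context nonlinear_wave
begin

text \<open>\<open>e\<close> solves \<open>p e - 2 = e\<close>, so that the exponents of the recursion are geometric up to the shift by
  \<open>e\<close>. \<open>E\<close> is the constant for which \<open>E p\<^bsup>e n\<^esup> D\<^bsup>p\<^sup>n\<^esup>\<close> solves the recursion of the
  coefficients, once \<open>4 (N + 1) (N + 2)\<close> is replaced by \<open>4 (1 + e)\<^sup>2 p\<^bsup>2 n + 2\<^esup>\<close>.\<close>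
lemma iterated_bound:
  fixes C b T :: real and n :: nat
  assumes b: "b > 0" and T: "0 \<le> T" "t0 \<le> T" and C: "C > 0"
    and bound: "\<And>x t. norm (x - x0) \<le> t - T - b \<Longrightarrow> C * (t - T) powr (1 - p) \<le> u (x, t)"
    and xt: "norm (x - x0) \<le> t - T - b"
  defines "e \<equiv> 2 / (p - 1)"
  defines "E \<equiv> (4 * (1 + e)\<^sup>2 * p powr (e + 2) / A) powr (1 / (p - 1))"
  shows "E * p powr (e * n) * (C / E) powr (p ^ n)
      * ((t - T - b)\<^sup>2 - (norm (x - x0))\<^sup>2) powr ((1 + e) * p ^ n - e)
      * (t - T) powr (- ((p + 1 + e) * p ^ n - e)) \<le> u (x, t)"
proof -
  have e: "e > 0" "p * e = e + 2" using p by (auto simp: e_def field_simps)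
  have B: "4 * (1 + e)\<^sup>2 * p powr (e + 2) / A > 0" using e A p by simp
  then have E: "E > 0" unfolding E_def powr_gt_zero by (rule less_imp_neq[symmetric])
  have "E powr (p - 1) = 4 * (1 + e)\<^sup>2 * p powr (e + 2) / A"
  proof -
    have "1 / (p - 1) * (p - 1) = 1" using p by simp
    then show ?thesis unfolding E_def powr_powr using powr_one[OF less_imp_le[OF B]] by simp
  qed
  then have "A * E powr (p - 1) = 4 * (1 + e)\<^sup>2 * p powr (e + 2)" using A by simp
  moreover have "E powr p = E powr (p - 1) * E"
    using powr_mult_base[of E "p - 1"] E by (simp add: mult.commute)
  ultimately have AE: "A * E powr p = 4 * (1 + e)\<^sup>2 * p powr (e + 2) * E"
    by (simp only: mult.assoc[symmetric])
  have D: "C / E > 0" using C E by simp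
  show ?thesis using xt
  proof (induction n arbitrary: x t)
    case 0
    define \<sigma> where "\<sigma> = (t - T - b)\<^sup>2 - (norm (x - x0))\<^sup>2"
    have \<theta>: "t - T > 0" "0 \<le> t - T - b" using order_trans[OF norm_ge_zero 0] b by auto
    have s: "0 \<le> \<sigma>" "\<sigma> \<le> (t - T)\<^sup>2"
    proof -
      show "0 \<le> \<sigma>" using 0 by (simp add: \<sigma>_def power_mono)
      have "(t - T - b)\<^sup>2 \<le> (t - T)\<^sup>2" using \<theta> b by (intro power_mono) auto
      then show "\<sigma> \<le> (t - T)\<^sup>2" using zero_le_power2[of "norm (x - x0)"] unfolding \<sigma>_def by linarith
    qed
    \<comment> \<open>The iteration starts from a = 1 and d = p + 1; the factor \<sigma> is gained
      at the price of \<open>(t - T)\<^sup>2\<close>.\<close>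
    have "C * \<sigma> * (t - T) powr (- (p + 1)) \<le> C * (t - T)\<^sup>2 * (t - T) powr (- (p + 1))"
      using C s by (intro mult_right_mono mult_left_mono) auto
    also have "\<dots> = C * (t - T) powr (1 - p)"
      using \<theta> powr_add[of "t - T" 2 "- (p + 1)"] by simp
    also have "\<dots> \<le> u (x, t)" by (rule bound[OF 0])
    finally show ?case using E C p s by (simp add: \<sigma>_def[symmetric])
  next
    case (Suc n)
    let ?a = "(1 + e) * p ^ n - e" and ?d = "(p + 1 + e) * p ^ n - e"
    let ?C = "E * p powr (e * n) * (C / E) powr (p ^ n)"
    have p1: "1 \<le> p ^ n" using p by simp
    have mono: "c - e \<le> c * p ^ n - e" if "c \<ge> 0" for c
      using mult_left_mono[OF p1 that] by simp
    have a: "?a \<ge> 1" using mono[of "1 + e"] e by simp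
    have d: "?d \<ge> 0" using order_trans[OF _ mono[of "p + 1 + e"], of 0] e p by simp
    have C': "?C > 0"
      by (intro mult_pos_pos E powr_gt_zero[THEN iffD2]) (use D p in auto)
    \<comment> \<open>By \<open>p * e = e + 2\<close> the shift by e reproduces itself.\<close>
    have N: "p * ?a + 2 = (1 + e) * p ^ Suc n - e" "p * ?d + 2 = (p + 1 + e) * p ^ Suc n - e"
      using e by (simp_all add: algebra_simps)
    define N where "N = p * ?a"
    have N0: "N > 0" using a p unfolding N_def by (intro mult_pos_pos) auto
    have "p ^ Suc n \<ge> 0" using p by simp
    then have N1: "N + 2 \<le> (1 + e) * p ^ Suc n" using e unfolding N_def N by simp
    have "E * p powr (e * Suc n) * (C / E) powr (p ^ Suc n) * (4 * (N + 1) * (N + 2)) \<le> A * ?C powr p"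
    proof -
      have "4 * (N + 1) * (N + 2) \<le> 4 * (N + 2) * (N + 2)" using N0 by (intro mult_right_mono) auto
      also have "\<dots> = 4 * (N + 2)\<^sup>2" by (simp add: power2_eq_square)
      also have "\<dots> \<le> 4 * ((1 + e) * p ^ Suc n)\<^sup>2" using N1 N0 by (intro mult_left_mono power_mono) auto
      also have "\<dots> = 4 * (1 + e)\<^sup>2 * p powr (2 + 2 * n)"
      proof -
        have "p powr (2 + 2 * n) = p powr (real (2 * Suc n))" by (simp add: algebra_simps)
        also have "\<dots> = p ^ (2 * Suc n)" using p by (subst powr_realpow) auto
        also have "\<dots> = (p ^ Suc n)\<^sup>2" by (simp only: power_mult[symmetric] mult.commute)
        finally show ?thesis by (simp only: power_mult_distrib) 
      qed
      finally have "E * p powr (e * Suc n) * (C / E) powr (p ^ Suc n) * (4 * (N + 1) * (N + 2))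
          \<le> E * p powr (e * Suc n) * (C / E) powr (p ^ Suc n) * (4 * (1 + e)\<^sup>2 * p powr (2 + 2 * n))"
        using E by (intro mult_left_mono) auto
      also have "\<dots> = 4 * (1 + e)\<^sup>2 * E * (C / E) powr (p ^ Suc n) * (p powr (e * Suc n) * p powr (2
          + 2 * n))"
        by (simp only: mult_ac)
      also have "p powr (e * Suc n) * p powr (2 + 2 * n) = p powr (e + 2) * p powr (e * n * p)"
      proof -
        have "e * n * p = (p * e) * n" by simp
        then have "e * Suc n + (2 + 2 * n) = (e + 2) + e * n * p" unfolding e(2)
            by (simp add: algebra_simps)
        then show ?thesis by (simp only: powr_add[symmetric])
      qed
      also have "4 * (1 + e)\<^sup>2 * E * (C / E) powr (p ^ Suc n) * (p powr (e + 2) * p powr (e * n * p))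
          = (4 * (1 + e)\<^sup>2 * p powr (e + 2) * E) * p powr (e * n * p) * (C / E) powr (p ^ Suc n)"
        by (simp only: mult_ac)
      also have "\<dots> = A * ?C powr p"
        unfolding AE[symmetric] using p by (simp add: powr_mult powr_powr mult_ac)
      finally show ?thesis .
    qed
    then have "E * p powr (e * Suc n) * (C / E) powr (p ^ Suc n) \<le> A * ?C powr p / (4 * (N + 1) * (N + 2))"
      using N0 by (simp add: pos_le_divide_eq)
    then have "E * p powr (e * Suc n) * (C / E) powr (p ^ Suc n)
        * ((t - T - b)\<^sup>2 - (norm (x - x0))\<^sup>2) powr (N + 2) * (t - T) powr (- (p * ?d + 2))
      \<le> A * ?C powr p / (4 * (N + 1) * (N + 2))
        * ((t - T - b)\<^sup>2 - (norm (x - x0))\<^sup>2) powr (N + 2) * (t - T) powr (- (p * ?d + 2))"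
      by (intro mult_right_mono) auto
    also have "\<dots> \<le> u (x, t)"
      unfolding N_def by (rule improved_bound[OF b T a d C' Suc.IH Suc.prems])
    finally show ?case unfolding N_def N .
  qed
qed

text \<open>On the axis \<sigma> is \<open>\<tau>\<^sup>2\<close>, and the n-th bound takes the form
  \<open>M * (p powr e) ^ n * X powr (p ^ n)\<close>. For a fixed \<tau> with X at least 1 it is
  unbounded in n, because p > 1 and e > 0.\<close>

lemma no_cone_bound:
  assumes p2: "p < 1 + sqrt 2" and b: "b > 0" and T: "0 \<le> T" "t0 \<le> T" and C: "C > 0"
    and bound: "\<And>x t. norm (x - x0) \<le> t - T - b \<Longrightarrow> C * (t - T) powr (1 - p) \<le> u (x, t)"
  shows False
proof -
  define e where "e = 2 / (p - 1)"
  define E where "E = (4 * (1 + e)\<^sup>2 * p powr (e + 2) / A) powr (1 / (p - 1))"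
  \<comment> \<open>\<kappa> = 2 (1 + e) - q is the total power of \<tau> in X for large \<tau>. It
    equals 2 / (p - 1) - (p - 1).\<close>
  define D q \<kappa> where "D = C / E" and "q = p + 1 + e" and "\<kappa> = 1 + e - p"
  have e: "e > 0" using p by (simp add: e_def)
  then have E: "E > 0" using A p by (simp add: E_def)
  have D: "D > 0" using C E by (simp add: D_def)
  have "(p - 1)\<^sup>2 < (sqrt 2)\<^sup>2" using p p2 by (intro power_strict_mono) auto
  then have "(p - 1) * (p - 1) < 2" by (simp add: power2_eq_square)
  then have \<kappa>: "\<kappa> > 0" using p by (simp add: \<kappa>_def e_def field_simps)
  \<comment> \<open>The first entry gives \<open>\<tau> + b \<le> 2 * \<tau>\<close>, the second
    \<open>2 powr q \<le> D * \<tau> powr \<kappa>\<close>; together they make X at least 1.\<close>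
  define \<tau> where "\<tau> = max b ((2 powr q / D) powr (1 / \<kappa>))"
  have \<tau>: "\<tau> > 0" "b \<le> \<tau>" using b by (auto simp: \<tau>_def)
  have "2 powr q / D = ((2 powr q / D) powr (1 / \<kappa>)) powr \<kappa>"
    using \<kappa> D by (simp add: powr_powr)
  also have "\<dots> \<le> \<tau> powr \<kappa>" using \<kappa> by (intro powr_mono2) (auto simp: \<tau>_def)
  finally have tk: "2 powr q \<le> D * \<tau> powr \<kappa>" using D by (simp add: field_simps)
  define X where "X = D * (\<tau>\<^sup>2) powr (1 + e) * (\<tau> + b) powr (- q)"
  have X: "X \<ge> 1"
  proof -
    have "1 \<le> D * \<tau> powr \<kappa> * 2 powr (- q)" using tk by (simp add: powr_minus field_simps)
    also have "\<dots> = D * ((\<tau> powr 2) powr (1 + e)) * (2 * \<tau>) powr (- q)"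
      using \<tau> unfolding powr_powr by (simp add: powr_mult \<kappa>_def q_def algebra_simps flip: powr_add)
    also have "\<dots> = D * (\<tau>\<^sup>2) powr (1 + e) * (2 * \<tau>) powr (- q)"
      using \<tau> by simp
    also have "\<dots> \<le> X"
      unfolding X_def using \<tau> b D e p by (intro mult_left_mono powr_mono2') (auto simp: q_def)
    finally show ?thesis .
  qed
  define M where "M = E * (\<tau>\<^sup>2) powr (- e) * (\<tau> + b) powr e"
  have M: "M > 0" using E \<tau> b by (simp add: M_def)
  have "M * (p powr e) ^ n \<le> u (x0, T + b + \<tau>)" for n
  proof -
    have "M * (p powr e) ^ n \<le> M * (p powr e) ^ n * X powr (p ^ n)"
      using M p X ge_one_powr_ge_zero[of X "p ^ n"] by simp
    also have "\<dots> = E * p powr (e * n) * D powr (p ^ n) * (\<tau>\<^sup>2) powr ((1 + e) * p ^ n - e)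
        * (\<tau> + b) powr (- (q * p ^ n - e))"
    proof -
      have "(p powr e) ^ n = p powr (e * n)" using p by (simp add: powr_powr flip: powr_realpow)
      moreover have "X powr (p ^ n) = D powr (p ^ n) * (\<tau>\<^sup>2) powr ((1 + e) * p ^ n) * (\<tau>
          + b) powr (- q * p ^ n)"
        using D by (simp only: X_def powr_mult powr_powr)
      moreover have "(\<tau>\<^sup>2) powr ((1 + e) * p ^ n - e) = (\<tau>\<^sup>2) powr ((1 + e) * p ^ n) * (\<tau>\<^sup>2) powr (- e)"
        "(\<tau> + b) powr (- (q * p ^ n - e)) = (\<tau> + b) powr (- q * p ^ n) * (\<tau> + b) powr e"
        by (simp_all flip: powr_add)
      ultimately show ?thesis by (simp only: M_def mult_ac)
    qed
    also have "\<dots> \<le> u (x0, T + b + \<tau>)"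
      using iterated_bound[OF b T C bound, of x0 "T + b + \<tau>" n] \<tau>
      by (simp add: e_def[symmetric] E_def[symmetric] D_def q_def add_ac)
    finally show ?thesis .
  qed
  moreover obtain n where "u (x0, T + b + \<tau>) / M < (p powr e) ^ n"
    using real_arch_pow[OF gr_one_powr[OF p e]] by blast
  ultimately show False using M by (simp add: field_simps not_le[symmetric])
qed

section \<open>Vanishing outside the backward cone\<close>

lemma nonzero_ball:
  assumes "t1 > 0" "u (x1, t1) \<noteq> 0" "d > 0"
  obtains \<delta> where "0 < \<delta>" "\<delta> \<le> d" "\<delta> \<le> t1"
    "\<And>y \<tau>. norm (y - x1) \<le> \<delta> \<Longrightarrow> \<bar>\<tau> - t1\<bar> \<le> \<delta> \<Longrightarrow> \<bar>u (x1, t1)\<bar> / 2 \<le> \<bar>u (y, \<tau>)\<bar>"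
proof -
  have "(x1, t1) \<in> half_space" using assms by (simp add: half_space_def)
  then obtain \<rho> where \<rho>: "\<rho> > 0"
    "\<And>z. z \<in> half_space \<Longrightarrow> dist z (x1, t1) < \<rho> \<Longrightarrow> dist (u z) (u (x1, t1)) < \<bar>u (x1, t1)\<bar> / 2"
    using continuous_u assms unfolding continuous_on_iff by (metis half_gt_zero zero_less_abs_iff)
  \<comment> \<open>\<open>t1\<close> keeps the times nonnegative; with \<open>\<rho> / 3\<close>
    the offsets in space and time add up to less than \<rho>.\<close>
  define \<delta> where "\<delta> = min (min d t1) (\<rho> / 3)"
  show thesis
  proof
    show "0 < \<delta>" "\<delta> \<le> d" "\<delta> \<le> t1" using assms \<rho> by (auto simp: \<delta>_def)
    fix y \<tau> assume y: "norm (y - x1) \<le> \<delta>" "\<bar>\<tau> - t1\<bar> \<le> \<delta>"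
    have "dist (y, \<tau>) (x1, t1) \<le> norm (y - x1) + \<bar>\<tau> - t1\<bar>"
      using norm_Pair_le[of "y - x1" "\<tau> - t1"] by (simp add: dist_norm)
    also have "\<dots> < \<rho>" using y \<rho> by (simp add: \<delta>_def)
    finally have "dist (u (y, \<tau>)) (u (x1, t1)) < \<bar>u (x1, t1)\<bar> / 2"
      using y by (intro \<rho>(2)) (auto simp: half_space_def \<delta>_def)
    then show "\<bar>u (x1, t1)\<bar> / 2 \<le> \<bar>u (y, \<tau>)\<bar>" unfolding dist_real_def by linarith
  qed
qed

text \<open>A positive value spreads to a box by continuity, to a shell by
  \<open>shell_bound\<close> and to a shifted cone by \<open>cone_bound\<close>, against
  \<open>no_cone_bound\<close>. The box size at most \<open>T - t0\<close> keeps the shell inside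
  the forward cone.\<close>

lemma not_positive_on_axis:
  assumes p2: "p < 1 + sqrt 2" and T: "0 < T" "t0 < T"
  shows "u (x0, T) \<le> 0"
proof (rule ccontr)
  assume "\<not> u (x0, T) \<le> 0"
  then have pos: "u (x0, T) > 0" by simp
  obtain \<delta> where \<delta>: "0 < \<delta>" "\<delta> \<le> T - t0" "\<delta> \<le> T"
    and big: "\<And>y \<tau>. norm (y - x0) \<le> \<delta> \<Longrightarrow> \<bar>\<tau> - T\<bar> \<le> \<delta> \<Longrightarrow> \<bar>u (x0, T)\<bar> / 2 \<le> \<bar>u (y, \<tau>)\<bar>"
    using nonzero_ball[of T x0 "T - t0"] pos T by auto
  define c where "c = A * (\<bar>u (x0, T)\<bar> / 2) powr p * \<delta> ^ 3 / 96"
  have c: "c > 0" using A pos \<delta> by (simp add: c_def)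
  have shell: "c / norm (y - x0) \<le> u (y, \<tau>)"
    if "norm (y - x0) \<ge> \<delta>" "\<bar>\<tau> - T - norm (y - x0)\<bar> \<le> \<delta> / 4" for y \<tau>
    unfolding c_def
  proof (rule shell_bound[OF \<delta>(1) _ \<delta>(3) big _ that])
    have "norm (y - x0) \<le> \<tau> - t0" "0 \<le> \<tau>" using that \<delta> by linarith+
    then show "(y, \<tau>) \<in> forward_cone x0 t0" by (simp add: forward_cone_def)
  qed (use pos in auto)
  \<comment> \<open>With \<eta> = \<delta> / 8 the thresholds 8 \<eta>, 2 \<eta> and 32 \<eta>
    become \<delta>, \<delta> / 4 and 4 \<delta>.\<close>
  have "A * c powr p * (\<delta> / 8) / 144 * (t - T) powr (1 - p) \<le> u (x, t)"
    if "norm (x - x0) \<le> t - T - 4 * \<delta>" for x t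
    by (rule cone_bound[OF _ c]) (use \<delta> T that shell in auto)
  then show False
    by (intro no_cone_bound[OF p2, of "4 * \<delta>" T "A * c powr p * (\<delta> / 8) / 144"]) (use \<delta> T A c in auto)
qed

text \<open>The axis point at time \<open>t1 + norm (x1 - x0)\<close> lies on the forward light cone
  of \<open>(x1, t1)\<close> and later than \<open>t0\<close>. A nonzero value at
  \<open>(x1, t1)\<close> would make \<open>u\<close> positive there: by \<open>shell_bound\<close>
  about \<open>x1\<close>, or by \<open>nonneg\<close> if \<open>x1\<close> is on the axis.\<close>

lemma vanishes_outside_backward_cone:
  assumes p2: "p < 1 + sqrt 2" and t1: "0 < t1" "t0 < norm (x1 - x0) + t1"
  shows "u (x1, t1) = 0"
proof (rule ccontr)
  assume nz: "u (x1, t1) \<noteq> 0"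
  define r where "r = norm (x1 - x0)"
  define T where "T = t1 + r"
  have r: "r \<ge> 0" by (simp add: r_def)
  have cone: "(x0, T) \<in> forward_cone x0 t0" using t1 r by (simp add: forward_cone_def T_def r_def)
  have "u (x0, T) > 0"
  proof (cases "r = 0")
    case True
    then show ?thesis using nonneg[OF cone] nz by (simp add: T_def r_def)
  next
    case False
    then obtain \<delta> where \<delta>: "0 < \<delta>" "\<delta> \<le> r" "\<delta> \<le> t1"
      and big: "\<And>y \<tau>. norm (y - x1) \<le> \<delta> \<Longrightarrow> \<bar>\<tau> - t1\<bar> \<le> \<delta> \<Longrightarrow> \<bar>u (x1, t1)\<bar> / 2 \<le> \<bar>u (y, \<tau>)\<bar>"
      using nonzero_ball[OF t1(1) nz, of r] r by (metis less_eq_real_def)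
    have "A * (\<bar>u (x1, t1)\<bar> / 2) powr p * \<delta> ^ 3 / 96 / norm (x0 - x1) \<le> u (x0, T)"
      by (rule shell_bound[OF \<delta>(1) _ \<delta>(3) big cone])
         (use nz \<delta> in \<open>auto simp: T_def r_def norm_minus_commute\<close>)
    moreover have "0 < A * (\<bar>u (x1, t1)\<bar> / 2) powr p * \<delta> ^ 3 / 96 / norm (x0 - x1)"
      using A nz \<delta> False by (auto simp: r_def)
    ultimately show ?thesis by linarith
  qed
  moreover have "0 < T" "t0 < T" using t1 r unfolding T_def r_def by linarith+
  ultimately show False using not_positive_on_axis[OF p2, of T] by simp
qed

end

theorem theorem1p2:
  fixes A p :: real and u :: "(real^3) \<times> real \<Rightarrow> real"
    and x0 :: "real^3" and t0 :: real
  assumes "A > 0" and "1 < p" and "p < 1 + sqrt 2"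
    and "C2_on half_space u"
    and "\<And>x t. t > 0 \<Longrightarrow> dAlembertian u (x, t) \<ge> A * \<bar>u (x, t)\<bar> powr p"
    and "\<And>x t. (x, t) \<in> forward_cone x0 t0 \<Longrightarrow> free_solution u (x, t) \<ge> 0"
  shows "compact (supp u) \<and> supp u \<subseteq> backward_cone x0 t0"
proof -
  from assms(4) obtain Du D2u where "C2_half_space u Du D2u"
    unfolding C2_on_def C2_half_space_def by blast
  then interpret C2_half_space u Du D2u .
  interpret nonlinear_wave u Du D2u A p x0 t0
    by unfold_locales (use assms dAlembertian_eq in auto)
  have zero: "u (x, t) = 0" if "0 < t" "t0 < norm (x - x0) + t" for x t
    using vanishes_outside_backward_cone[OF assms(3)] that by blast
  have "(x, t) \<in> backward_cone x0 t0" if xt: "(x, t) \<in> half_space" "u (x, t) \<noteq> 0" for x t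
  proof (rule ccontr)
    assume "(x, t) \<notin> backward_cone x0 t0"
    then have t: "0 \<le> t" "t0 < norm (x - x0) + t" using xt by (auto simp: backward_cone_def half_space_def)
    \<comment> \<open>This limit from later times covers t = 0, where \<open>zero\<close> says
      nothing.\<close>
    have lim: "((\<lambda>s. u (x, s)) \<longlongrightarrow> u (x, t)) (at_right t)"
    proof -
      have "continuous_on {t..} (\<lambda>s. u (x, s))"
        using t by (intro continuous_intros continuous_on_half_space) (auto simp: half_space_def)
      then have "((\<lambda>s. u (x, s)) \<longlongrightarrow> u (x, t)) (at t within {t..})" by (simp add: continuous_on_def)
      then show ?thesis by (rule tendsto_within_subset) auto
    qed
    have ev: "eventually (\<lambda>s. u (x, s) = 0) (at_right t)"
      using t zero by (auto simp: eventually_at_filter intro!: always_eventually)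
    have "u (x, t) = 0"
      by (rule tendsto_unique[OF trivial_limit_at_right_real lim tendsto_eventually[OF ev]])
    with xt show False by simp
  qed
  then have sub: "{z \<in> half_space. u z \<noteq> 0} \<subseteq> backward_cone x0 t0" by auto
  have eq: "backward_cone x0 t0 = {z. norm (fst z - x0) \<le> t0 - snd z} \<inter> {z. 0 \<le> snd z}"
    by (auto simp: backward_cone_def)
  have cl: "closed (backward_cone x0 t0)"
    unfolding eq by (intro closed_Int closed_Collect_le continuous_intros)
  have "backward_cone x0 t0 \<subseteq> cball x0 t0 \<times> {0..t0}"
  proof
    fix z assume "z \<in> backward_cone x0 t0"
    then obtain x t where z: "z = (x, t)" "norm (x - x0) \<le> t0 - t" "0 \<le> t"
      by (auto simp: backward_cone_def)
    moreover have "0 \<le> norm (x - x0)" by simp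
    ultimately have "norm (x - x0) \<le> t0" "t \<le> t0" by linarith+
    then show "z \<in> cball x0 t0 \<times> {0..t0}"
      using z by (simp add: dist_norm norm_minus_commute)
  qed
  then have bd: "bounded (backward_cone x0 t0)"
    using bounded_Times[OF bounded_cball bounded_closed_interval] bounded_subset by blast
  have "supp u \<subseteq> backward_cone x0 t0"
    unfolding supp_def by (rule closure_minimal[OF sub cl])
  moreover from this have "compact (supp u)"
    using bd bounded_subset unfolding supp_def by (auto simp: compact_eq_bounded_closed)
  ultimately show ?thesis by blast
qed

end
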